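(* Let $SG$ be a signed intersection graph and let $v_1,v_2\in V(SG)$. If $v_1$ and $v_2$ are adjacent, the degree of $v_1$ is $1$, and the sign of $v_1$ is positive, then $$IP_{SG}(z)=IP_{SG-v_1}(z)+(2z^{2})\,IP_{SG-v_1-v_2}(z).$$
   Context: Ribbon graphs are finite, possibly non-orientable. For a ribbon graph $G$, let $v(G),e(G),f(G)$ be its numbers of vertices, edges and boundary components. For connected $G$ the Euler genus $\varepsilon(G)$ is defined by $2-\varepsilon(G)=v(G)-e(G)+f(G)$. For $A\subseteq E(G)$ the partial dual $G^{A}$ is obtained as follows: take the spanning ribbon subgraph $(V(G),A)$, glue a disc to $G$ along each boundary component of this subgraph (these discs are the vertex-discs of $G^A$), and remove the interiors of all vertex-discs of $G$; the edge-ribbons are kept as the edges of $G^A$. The partial-dual Euler genus polynomial of $G$ is ${}^{\partial}\varepsilon_{G}(z)=\sum_{A\subseteq E(G)}z^{\varepsilon(G^{A})}$. A bouquet is a ribbon graph with exactly one vertex (the bouquet without edges is allowed; its signed intersection graph is the empty graph). A loop $e$ at the vertex-disc $v$ is twisted if $e\cup v$ is homeomorphic to a Möbius band, and untwisted otherwise. The intersection graph $I(B)$ of a bouquet $B$ is the graph with vertex set $E(B)$ in which distinct $e$ and $f$ are adjacent if and only if their ends are met in the cyclic order $e\cdots f\cdots e\cdots f\cdots$ when travelling around the boundary of the unique vertex of $B$. The signed intersection graph $SI(B)$ is $I(B)$ together with a sign at each vertex: $+$ if the corresponding edge of $B$ is an untwisted loop, $-$ if it is a twisted loop. A graph $SG$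 with a sign $+$ or $-$ at each vertex is called a signed intersection graph if $SG=SI(B)$ for some bouquet $B$. Its intersection polynomial is $IP_{SG}(z):={}^{\partial}\varepsilon_{B}(z)$ for any bouquet $B$ with $SG=SI(B)$; this does not depend on the choice of $B$, since bouquets with the same signed intersection graph have the same partial-dual Euler genus polynomial. $SG-v$ denotes deletion of the vertex $v$ (the other vertices keep their signs); deleting vertices from a signed intersection graph gives a signed intersection graph, since it corresponds to deleting edges of the bouquet. *)

theory Defs
  imports "HOL-Computational_Algebra.Polynomial"
begin

text \<open>
  Every edge-ribbon is parametrised as a rectangle \<open>[0,1] \<times> [0,1]\<close>, glued to vertex-discs along its
  two ends \<open>{i} \<times> [0,1]\<close>; the segments \<open>[0,1] \<times> {j}\<close> are its free sides. The triple \<open>(e, i, j)\<close> is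
  the corner \<open>(i, j)\<close> of the ribbon \<open>e\<close>, with \<open>False\<close> for \<open>0\<close> and \<open>True\<close> for \<open>1\<close>.

  Removing the ends of the ribbons from the boundary circles of the vertex-discs leaves arcs joining
  corners in pairs, together with full circles, one for each isolated vertex. The pairing \<open>rg_arc\<close>
  and the number of isolated vertices determine the ribbon graph; no orientability is imposed.
\<close>

type_synonym 'e corner = "'e \<times> bool \<times> bool"

record 'e ribbon_graph =
  rg_edges :: "'e set"
  rg_arc :: "'e corner \<Rightarrow> 'e corner"
  rg_isolated :: nat

definition corners :: "'e ribbon_graph \<Rightarrow> 'e corner set" where
  "corners G = rg_edges G \<times> UNIV"

definition ribbon_graph :: "'e ribbon_graph \<Rightarrow> bool" where
  "ribbon_graph G \<longleftrightarrow> finite (rg_edges G) \<and>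
     (\<forall>x\<in>corners G. rg_arc G x \<in> corners G \<and> rg_arc G x \<noteq> x \<and> rg_arc G (rg_arc G x) = x)"

fun across_end :: "'e corner \<Rightarrow> 'e corner" where
  "across_end (e, i, j) = (e, i, \<not> j)"

fun along_side :: "'e corner \<Rightarrow> 'e corner" where
  "along_side (e, i, j) = (e, \<not> i, j)"

text \<open>The orbits of the group generated by two involutions \<open>f\<close> and \<open>g\<close> of \<open>S\<close>.\<close>

definition orbits :: "'a set \<Rightarrow> ('a \<Rightarrow> 'a) \<Rightarrow> ('a \<Rightarrow> 'a) \<Rightarrow> 'a set set" where
  "orbits S f g = S // {(x, y). x \<in> S \<and> (y = f x \<or> y = g x)}\<^sup>*"

text \<open>
  A boundary component of the spanning ribbon subgraph \<open>(V(G), A)\<close> runs along the arcs, the sides of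
  the ribbons in \<open>A\<close>, and the segments of vertex boundary where the ends of the other ribbons
  were attached. The boundary circle of an isolated vertex contains no corner and is counted apart.
\<close>

definition num_subgraph_boundaries :: "'e ribbon_graph \<Rightarrow> 'e set \<Rightarrow> nat" where
  "num_subgraph_boundaries G A =
     card (orbits (corners G) (rg_arc G)
       (\<lambda>x. if fst x \<in> A then along_side x else across_end x)) + rg_isolated G"

definition num_vertices :: "'e ribbon_graph \<Rightarrow> nat" where
  "num_vertices G = card (orbits (corners G) (rg_arc G) across_end) + rg_isolated G"

definition num_edges :: "'e ribbon_graph \<Rightarrow> nat" where
  "num_edges G = card (rg_edges G)"

definition num_boundaries :: "'e ribbon_graph \<Rightarrow> nat" where
  "num_boundaries G = card (orbits (corners G) (rg_arc G) along_side) + rg_isolated G"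

text \<open>Meant for connected ribbon graphs, for which the integer below is nonnegative.\<close>

definition euler_genus :: "'e ribbon_graph \<Rightarrow> nat" where
  "euler_genus G =
     nat (2 - (int (num_vertices G) - int (num_edges G) + int (num_boundaries G)))"

text \<open>
  In the partial dual \<open>G\<^sup>A\<close> the ribbons and the arcs are the same, but the ribbons in \<open>A\<close> are attached
  to the new vertex-discs along their former sides. So ends and sides, that is, the two
  coordinates of the rectangle, are interchanged for these ribbons.
  Lemma \<open>num_vertices_partial_dual\<close> confirms that the vertex-discs of \<open>G\<^sup>A\<close> correspond to the
  boundary components of \<open>(V(G), A)\<close>.
\<close>

fun swap_ends_sides :: "'e set \<Rightarrow> 'e corner \<Rightarrow> 'e corner" where
  "swap_ends_sides A (e, i, j) = (if e \<in> A then (e, j, i) else (e, i, j))"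

definition partial_dual :: "'e ribbon_graph \<Rightarrow> 'e set \<Rightarrow> 'e ribbon_graph" where
  "partial_dual G A = G\<lparr>rg_arc := swap_ends_sides A \<circ> rg_arc G \<circ> swap_ends_sides A\<rparr>"

definition partial_dual_genus_poly :: "'e ribbon_graph \<Rightarrow> int poly" where
  "partial_dual_genus_poly G =
     (\<Sum>A\<in>Pow (rg_edges G). monom 1 (euler_genus (partial_dual G A)))"

definition bouquet :: "'e ribbon_graph \<Rightarrow> bool" where
  "bouquet B \<longleftrightarrow> ribbon_graph B \<and> num_vertices B = 1"

text \<open>
  Travelling around a vertex boundary: cross the ribbon end that begins at the given corner, then
  follow the arc to the corner at which the next ribbon end begins. In a bouquet, \<open>2 |E|\<close> such
  steps go once around the vertex and cross every ribbon end exactly once.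
\<close>

definition next_end :: "'e ribbon_graph \<Rightarrow> 'e corner \<Rightarrow> 'e corner" where
  "next_end G x = rg_arc G (across_end x)"

definition interlaced :: "'e ribbon_graph \<Rightarrow> 'e \<Rightarrow> 'e \<Rightarrow> bool" where
  "interlaced B e f \<longleftrightarrow>
     (\<exists>x i j k. x \<in> corners B \<and> 0 < i \<and> i < j \<and> j < k \<and> k < 2 * card (rg_edges B) \<and>
        fst x = e \<and> fst ((next_end B ^^ i) x) = f \<and>
        fst ((next_end B ^^ j) x) = e \<and> fst ((next_end B ^^ k) x) = f)"

text \<open>
  A rectangle glued to a disc along the ends \<open>{0} \<times> [0,1]\<close> and \<open>{1} \<times> [0,1]\<close> gives a Moebius band
  exactly if travelling around the disc traverses both ends in the same direction of the second
  coordinate (for an annulus, the two directions are opposite).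
\<close>

definition twisted :: "'e ribbon_graph \<Rightarrow> 'e \<Rightarrow> bool" where
  "twisted B e \<longleftrightarrow> (\<exists>n. (next_end B ^^ n) (e, False, False) = (e, True, False))"

text \<open>The vertices in \<open>sg_pos\<close> carry the sign \<open>+\<close>, all other vertices the sign \<open>-\<close>.\<close>

record 'v signed_graph =
  sg_verts :: "'v set"
  sg_edges :: "'v set set"
  sg_pos :: "'v set"

definition sg_degree :: "'v signed_graph \<Rightarrow> 'v \<Rightarrow> nat" where
  "sg_degree SG v = card {u \<in> sg_verts SG. {v, u} \<in> sg_edges SG}"

definition delete_vertex :: "'v signed_graph \<Rightarrow> 'v \<Rightarrow> 'v signed_graph" where
  "delete_vertex SG v =
     \<lparr>sg_verts = sg_verts SG - {v},
      sg_edges = {d \<in> sg_edges SG. v \<notin> d},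
      sg_pos = sg_pos SG - {v}\<rparr>"

definition SI :: "'e ribbon_graph \<Rightarrow> 'e signed_graph" where
  "SI B =
     \<lparr>sg_verts = rg_edges B,
      sg_edges = {{e, f} |e f. e \<in> rg_edges B \<and> f \<in> rg_edges B \<and> e \<noteq> f \<and> interlaced B e f},
      sg_pos = {e \<in> rg_edges B. \<not> twisted B e}\<rparr>"

definition signed_intersection_graph :: "'e signed_graph \<Rightarrow> bool" where
  "signed_intersection_graph SG \<longleftrightarrow> (\<exists>B. bouquet B \<and> SG = SI B)"

definition intersection_poly :: "'e signed_graph \<Rightarrow> int poly" where
  "intersection_poly SG =
     (THE p. \<exists>B. bouquet B \<and> SG = SI B \<and> p = partial_dual_genus_poly B)"

lemma swap_ends_sides_invol [simp]: "swap_ends_sides A (swap_ends_sides A x) = x"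
  by (cases x) auto

lemma swap_ends_sides_corners [simp]: "swap_ends_sides A x \<in> corners G \<longleftrightarrow> x \<in> corners G"
  by (cases x) (auto simp: corners_def)

lemma card_orbits_conjugate:
  assumes inv: "\<And>x. s (s x) = x" and S: "\<And>x. s x \<in> S \<longleftrightarrow> x \<in> S"
    and f: "\<And>x. f' x = s (f (s x))" and g: "\<And>x. g' x = s (g (s x))"
  shows "card (orbits S f' g') = card (orbits S f g)"
proof -
  define R where "R = {(x, y). x \<in> S \<and> (y = f x \<or> y = g x)}"
  define R' where "R' = {(x, y). x \<in> S \<and> (y = f' x \<or> y = g' x)}"
  have move: "s y = u \<longleftrightarrow> y = s u" for y u
    using inv by metis
  have step: "(x, y) \<in> R' \<longleftrightarrow> (s x, s y) \<in> R" for x y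
    by (simp add: R_def R'_def S f g move)
  have fwd: "(s x, s y) \<in> R\<^sup>*" if "(x, y) \<in> R'\<^sup>*" for x y
    using that by induction (auto simp: step intro: rtrancl_into_rtrancl)
  have bwd: "(s x, s y) \<in> R'\<^sup>*" if "(x, y) \<in> R\<^sup>*" for x y
    using that by induction (auto simp: step inv intro: rtrancl_into_rtrancl)
  have img: "R'\<^sup>* `` {s x} = s ` (R\<^sup>* `` {x})" for x
  proof (intro set_eqI iffI)
    fix y assume "y \<in> R'\<^sup>* `` {s x}"
    then have "(x, s y) \<in> R\<^sup>*" using fwd[of "s x" y] by (simp add: inv)
    then show "y \<in> s ` (R\<^sup>* `` {x})" by (intro image_eqI[of _ _ "s y"]) (simp_all add: inv)
  next
    fix y assume "y \<in> s ` (R\<^sup>* `` {x})"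
    then show "y \<in> R'\<^sup>* `` {s x}" using bwd by auto
  qed
  have "s ` S = S"
  proof (intro set_eqI iffI)
    fix x assume "x \<in> S"
    then show "x \<in> s ` S" using S inv by (intro image_eqI[of _ _ "s x"]) simp_all
  qed (use S in auto)
  then have "S // R'\<^sup>* = (\<lambda>x. R'\<^sup>* `` {x}) ` s ` S"
    by (simp add: quotient_def UNION_singleton_eq_range)
  also have "\<dots> = (`) s ` (S // R\<^sup>*)"
    by (simp add: quotient_def UNION_singleton_eq_range img image_image)
  finally have eq: "S // R'\<^sup>* = (`) s ` (S // R\<^sup>*)" .
  have "inj s" by (metis inv injI)
  then have "inj_on ((`) s) (S // R\<^sup>*)" by (simp add: inj_on_def inj_image_eq_iff)
  then have "card (S // R'\<^sup>*) = card (S // R\<^sup>*)"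
    unfolding eq by (rule card_image)
  then show ?thesis
    by (simp only: orbits_def R_def R'_def)
qed

lemma num_vertices_partial_dual:
  "num_vertices (partial_dual G A) = num_subgraph_boundaries G A"
proof -
  have "card (orbits (corners G) (swap_ends_sides A \<circ> rg_arc G \<circ> swap_ends_sides A) across_end) =
    card (orbits (corners G) (rg_arc G)
      (\<lambda>x. if fst x \<in> A then along_side x else across_end x))"
    by (rule card_orbits_conjugate[where s = "swap_ends_sides A"]) (auto split: if_splits)
  then show ?thesis
    by (simp add: num_vertices_def num_subgraph_boundaries_def partial_dual_def corners_def)
qed

end

theory Submission
  imports Defs "HOL-Library.Sublist"
begin

text \<open>
  Let \<open>f(A)\<close> be the number of boundary components of \<open>(V(B), A)\<close>. There are \<open>2 ^ f(A)\<close> functions from the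
  corners to \<open>GF(2)\<close> that are constant on boundary components. Such a function is determined by its
  value at a base point and by the set \<open>x \<subseteq> A\<close> of edges at whose ends it changes, and \<open>x\<close> comes from a
  function exactly if it lies in the kernel of the adjacency matrix of \<open>SI B\<close> restricted to \<open>A\<close>, where
  twisted loops give diagonal entries 1. Hence \<open>2 ^ f(A) = 2 |ker A|\<close>, so that \<open>f\<close> depends only on
  \<open>SI B\<close>, and so does the genus \<open>|E| + 2 - f(A) - f(E - A)\<close> of the partial dual.

  If \<open>v1\<close> is positive and its only neighbour is \<open>v2\<close>, then the kernel for \<open>A\<close> has the size of the
  kernel for \<open>A - {v1, v2}\<close> if \<open>A\<close> contains both vertices, and twice the size of the kernel for
  \<open>A - {v1}\<close> if it contains only \<open>v1\<close>. So the sets \<open>A\<close> that separate \<open>v1\<close> from \<open>v2\<close> contribute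
  the polynomial of \<open>SG - v1\<close>, and those that do not contribute \<open>2 z\<^sup>2\<close> times that of
  \<open>SG - v1 - v2\<close>.
\<close>

section \<open>Corner involutions, orbit counts and the genus of a partial dual\<close>

lemma across_end_across_end [simp]: "across_end (across_end y) = y"
  by (cases y) auto

lemma across_end_neq [simp]: "across_end y \<noteq> y"
  by (cases y) auto

lemma fst_across_end [simp]: "fst (across_end y) = fst y"
  by (cases y) auto

lemma along_side_along_side [simp]: "along_side (along_side y) = y"
  by (cases y) auto

lemma fst_along_side [simp]: "fst (along_side y) = fst y"
  by (cases y) auto

lemma in_corners_iff: "y \<in> corners G \<longleftrightarrow> fst y \<in> rg_edges G"
  by (cases y) (auto simp: corners_def)

lemma orbits_cong:
  assumes "\<And>x. x \<in> S \<Longrightarrow> f x = f' x" "\<And>x. x \<in> S \<Longrightarrow> g x = g' x"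
  shows "orbits S f g = orbits S f' g'"
proof -
  have "{(x, y). x \<in> S \<and> (y = f x \<or> y = g x)} = {(x, y). x \<in> S \<and> (y = f' x \<or> y = g' x)}"
    using assms by auto
  then show ?thesis by (simp add: orbits_def)
qed

text \<open>Invariant sets are the unions of orbits, and distinct families of orbits have distinct
  unions. This trades an orbit count for the number of solutions of a linear system.\<close>

lemma card_invariant_sets:
  assumes "finite S"
    and f: "\<And>x. x \<in> S \<Longrightarrow> f x \<in> S \<and> f (f x) = x"
    and g: "\<And>x. x \<in> S \<Longrightarrow> g x \<in> S \<and> g (g x) = x"
  shows "card {h. h \<subseteq> S \<and> (\<forall>x\<in>S. (f x \<in> h \<longleftrightarrow> x \<in> h) \<and> (g x \<in> h \<longleftrightarrow> x \<in> h))} =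
    2 ^ card (orbits S f g)"
    (is "card ?Inv = _")
proof -
  define R where "R = {(x, y). x \<in> S \<and> (y = f x \<or> y = g x)}"
  have "sym R"
    using f g by (auto simp: R_def sym_def)
  then have symR: "(y, x) \<in> R\<^sup>*" if "(x, y) \<in> R\<^sup>*" for x y
    using that by (meson sym_rtrancl symD)
  have inS: "y \<in> S" if "(x, y) \<in> R\<^sup>*" "x \<in> S" for x y
    using that by induction (auto simp: R_def f g)
  have inv: "y \<in> h \<longleftrightarrow> x \<in> h" if "(x, y) \<in> R\<^sup>*" "h \<in> ?Inv" for x y h
    using that by induction (auto simp: R_def f g)
  have class_eq: "R\<^sup>* `` {x} = R\<^sup>* `` {y}" if "(x, y) \<in> R\<^sup>*" for x y
    using that symR[OF that] by (auto intro: rtrancl_trans)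
  have class_eq': "C = R\<^sup>* `` {y}" if "C \<in> S // R\<^sup>*" "y \<in> C" for C y
    using that class_eq by (auto simp: quotient_def)
  \<comment> \<open>Classes are equal or disjoint, so a point lies in a union of classes only
    through its own class.\<close>
  have Ur: "y \<in> \<Union>X \<longleftrightarrow> R\<^sup>* `` {y} \<in> X" if "X \<subseteq> S // R\<^sup>*" for X y
    using that class_eq' by (metis ImageI UnionE UnionI insertI1 rtrancl.rtrancl_refl subsetD)
  have "bij_betw Union (Pow (S // R\<^sup>*)) ?Inv"
  proof (rule bij_betw_byWitness[where f' = "\<lambda>h. {C \<in> S // R\<^sup>*. C \<subseteq> h}"]; (intro ballI)?)
    show "Union ` Pow (S // R\<^sup>*) \<subseteq> ?Inv"
    proof (rule image_subsetI)
      fix X assume "X \<in> Pow (S // R\<^sup>*)"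
      then have X: "X \<subseteq> S // R\<^sup>*" by simp
      have "\<Union>X \<subseteq> S" using X inS by (auto simp: quotient_def)
      moreover have "(f x \<in> \<Union>X \<longleftrightarrow> x \<in> \<Union>X) \<and> (g x \<in> \<Union>X \<longleftrightarrow> x \<in> \<Union>X)" if "x \<in> S" for x
      proof -
        have "(x, f x) \<in> R\<^sup>*" "(x, g x) \<in> R\<^sup>*" using that by (auto simp: R_def)
        then have "R\<^sup>* `` {x} = R\<^sup>* `` {f x}" "R\<^sup>* `` {x} = R\<^sup>* `` {g x}"
          by (auto dest: class_eq)
        then show ?thesis unfolding Ur[OF X] by simp
      qed
      ultimately show "\<Union>X \<in> ?Inv" by blast
    qed
    show "(\<lambda>h. {C \<in> S // R\<^sup>*. C \<subseteq> h}) ` ?Inv \<subseteq> Pow (S // R\<^sup>*)" by auto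
    show "{C \<in> S // R\<^sup>*. C \<subseteq> \<Union>X} = X" if "X \<in> Pow (S // R\<^sup>*)" for X
    proof -
      have X: "X \<subseteq> S // R\<^sup>*" using that by simp
      have "C \<in> X" if C: "C \<in> S // R\<^sup>*" "C \<subseteq> \<Union>X" for C
      proof -
        obtain y where y: "y \<in> S" "C = R\<^sup>* `` {y}" using C by (auto simp: quotient_def)
        then have "y \<in> \<Union>X" using C by auto
        then show ?thesis using Ur[OF X] y by simp
      qed
      then show ?thesis using X by auto
    qed
    show "\<Union>{C \<in> S // R\<^sup>*. C \<subseteq> h} = h" if "h \<in> ?Inv" for h
    proof -
      have "y \<in> \<Union>{C \<in> S // R\<^sup>*. C \<subseteq> h}" if "y \<in> h" for y
      proof
        show "y \<in> R\<^sup>* `` {y}" by simp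
        have "R\<^sup>* `` {y} \<subseteq> h" using inv \<open>y \<in> h\<close> \<open>h \<in> ?Inv\<close> by blast
        moreover have "y \<in> S" using \<open>y \<in> h\<close> \<open>h \<in> ?Inv\<close> by blast
        ultimately show "R\<^sup>* `` {y} \<in> {C \<in> S // R\<^sup>*. C \<subseteq> h}" by (auto intro: quotientI)
      qed
      then show ?thesis by auto
    qed
  qed
  then have "card ?Inv = card (Pow (S // R\<^sup>*))"
    by (simp add: bij_betw_same_card)
  moreover have "finite (S // R\<^sup>*)"
    by (simp add: quotient_def \<open>finite S\<close>)
  ultimately show ?thesis
    by (simp add: card_Pow orbits_def R_def)
qed

text \<open>Conjugation by \<open>swap_ends_sides A\<close> exchanges sides and ends of the ribbons
  in \<open>A\<close>, so a boundary of the dual follows the sides of exactly the ribbons outside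
  \<open>A\<close>.\<close>

lemma num_boundaries_partial_dual:
  "num_boundaries (partial_dual G A) = num_subgraph_boundaries G (rg_edges G - A)"
proof -
  have "card (orbits (corners G) (swap_ends_sides A \<circ> rg_arc G \<circ> swap_ends_sides A) along_side) =
    card (orbits (corners G) (rg_arc G) (\<lambda>x. if fst x \<in> A then across_end x else along_side x))"
    by (rule card_orbits_conjugate[where s = "swap_ends_sides A"]) (auto split: if_splits)
  also have "orbits (corners G) (rg_arc G) (\<lambda>x. if fst x \<in> A then across_end x else along_side x) =
    orbits (corners G) (rg_arc G)
      (\<lambda>x. if fst x \<in> rg_edges G - A then along_side x else across_end x)"
    by (rule orbits_cong) (auto simp: in_corners_iff)
  finally show ?thesis
    unfolding num_boundaries_def num_subgraph_boundaries_def by (simp add: partial_dual_def corners_def comp_def)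
qed

lemma euler_genus_partial_dual:
  "euler_genus (partial_dual G A) =
    nat (int (card (rg_edges G)) + 2 - int (num_subgraph_boundaries G A)
      - int (num_subgraph_boundaries G (rg_edges G - A)))"
  unfolding euler_genus_def num_vertices_partial_dual num_boundaries_partial_dual
  by (simp add: num_edges_def partial_dual_def algebra_simps)

subsection \<open>The boundary of the vertex of a bouquet as a cyclic word\<close>

text \<open>
  Going once around the vertex, one records for every ribbon end the corner that is met first; the
  other corner of that end is its image under \<^const>\<open>across_end\<close>. Deleting an edge deletes its two
  letters from the word.
\<close>

definition boundary_word :: "'e set \<Rightarrow> 'e corner list \<Rightarrow> bool" where
  "boundary_word E L \<longleftrightarrow> finite E \<and> distinct L \<and> (\<forall>y\<in>set L. fst y \<in> E) \<and>
     (\<forall>y. fst y \<in> E \<longrightarrow> (y \<in> set L) \<noteq> (across_end y \<in> set L))"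

text \<open>A walk through ribbon ends cannot see a vertex without ends; the edgeless bouquet
  therefore appears as the empty word with one isolated vertex.\<close>

definition traces :: "'e ribbon_graph \<Rightarrow> 'e corner list \<Rightarrow> bool" where
  "traces B L \<longleftrightarrow> ribbon_graph B \<and> boundary_word (rg_edges B) L \<and>
     (\<forall>i<length L. next_end B (L ! i) = L ! (Suc i mod length L)) \<and>
     rg_isolated B = (if L = [] then 1 else 0)"

lemma across_end_in_boundary_word:
  assumes "boundary_word E L" "fst y \<in> E"
  shows "across_end y \<in> set L \<longleftrightarrow> y \<notin> set L"
  using assms unfolding boundary_word_def by blast

lemma fst_in_boundary_word:
  assumes "boundary_word E L" "y \<in> set L"
  shows "fst y \<in> E"
  using assms unfolding boundary_word_def by blast

text \<open>A word contains exactly one of the two corners of each ribbon end. The second coordinate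
  names the end; the third records on which side the walk enters it.\<close>

lemma boundary_word_two_ends:
  assumes "boundary_word E L" "e \<in> E"
  obtains j0 j1 where "{y \<in> set L. fst y = e} = {(e, False, j0), (e, True, j1)}"
proof -
  have *: "(e, b, True) \<in> set L \<longleftrightarrow> (e, b, False) \<notin> set L" for b
    using across_end_in_boundary_word[OF assms(1), of "(e, b, False)"] assms(2) by simp
  have "y \<in> {y \<in> set L. fst y = e} \<longleftrightarrow>
    y \<in> {(e, False, (e, False, True) \<in> set L), (e, True, (e, True, True) \<in> set L)}" for y
  proof (cases y)
    case (fields f b j)
    show ?thesis unfolding fields by (cases b; cases j) (auto simp: *)
  qed
  then have "{y \<in> set L. fst y = e} =
    {(e, False, (e, False, True) \<in> set L), (e, True, (e, True, True) \<in> set L)}"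
    by (rule set_eqI)
  then show thesis by (rule that)
qed

lemma count_list_boundary_word:
  assumes "boundary_word E L" "e \<in> E"
  shows "count_list (map fst L) e = 2"
proof -
  obtain j0 j1 where *: "{y \<in> set L. fst y = e} = {(e, False, j0), (e, True, j1)}"
    using assms by (rule boundary_word_two_ends)
  have "count_list (map fst L) e = length (filter (\<lambda>y. fst y = e) L)"
    by (induction L) auto
  also have "\<dots> = card {y \<in> set L. fst y = e}"
    using assms(1) by (simp add: boundary_word_def distinct_length_filter Int_def conj_commute)
  also have "\<dots> = 2" by (simp add: *)
  finally show ?thesis .
qed

lemma length_boundary_word:
  assumes "boundary_word E L"
  shows "length L = 2 * card E"
proof -
  have "sum (count_list (map fst L)) E = length (map fst L)"
    using assms by (intro sum_count_set) (auto simp: boundary_word_def)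
  then show ?thesis using assms by (simp add: count_list_boundary_word)
qed

lemma boundary_word_filter:
  assumes "boundary_word E L"
  shows "boundary_word (E - {v}) (filter (\<lambda>y. fst y \<noteq> v) L)"
proof -
  have "finite E" "distinct L" using assms by (simp_all add: boundary_word_def)
  moreover have "(y \<in> set (filter (\<lambda>y. fst y \<noteq> v) L)) \<noteq>
      (across_end y \<in> set (filter (\<lambda>y. fst y \<noteq> v) L))" if "fst y \<in> E - {v}" for y
    using that across_end_in_boundary_word[OF assms, of y] by auto
  moreover have "\<forall>y\<in>set (filter (\<lambda>y. fst y \<noteq> v) L). fst y \<in> E - {v}"
    using fst_in_boundary_word[OF assms] by auto
  ultimately show ?thesis
    unfolding boundary_word_def by (metis distinct_filter finite_Diff)
qed

lemma nth_in_corners: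
  assumes "traces B L" "i < length L"
  shows "L ! i \<in> corners B"
  using assms unfolding traces_def in_corners_iff by (metis fst_in_boundary_word nth_mem)

lemma traces_nonadjacent:
  assumes "traces B L" "i < length L" "j < length L"
  shows "across_end (L ! i) \<noteq> L ! j"
  using assms unfolding traces_def
  by (metis across_end_in_boundary_word fst_in_boundary_word nth_mem)

text \<open>The same circle travelled in the opposite direction: the ends come in reverse order, and
  each is entered at its other corner.\<close>

lemma traces_rev:
  assumes "traces B L"
  shows "traces B (map across_end (rev L))"
proof -
  let ?N = "length L"
  have *: "rg_arc B (L ! (Suc i mod ?N)) = across_end (L ! i)" if "i < ?N" for i
  proof -
    have "L ! (Suc i mod ?N) = rg_arc B (across_end (L ! i))"
      using assms that by (simp add: traces_def next_end_def)
    moreover have "across_end (L ! i) \<in> corners B"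
      using nth_in_corners[OF assms that] by (simp add: in_corners_iff)
    ultimately show ?thesis using assms by (simp add: traces_def ribbon_graph_def)
  qed
  have "next_end B (map across_end (rev L) ! i) = map across_end (rev L) ! (Suc i mod ?N)"
    if "i < ?N" for i
  proof (cases "Suc i = ?N")
    case True
    then have "Suc i mod ?N = 0" "i = ?N - 1" "0 < ?N" by auto
    then show ?thesis using *[of i] by (simp add: next_end_def rev_nth)
  next
    case False
    then have "Suc (?N - Suc (Suc i)) = ?N - Suc i" using that by simp
    then show ?thesis using *[of "?N - Suc (Suc i)"] that False
      by (simp add: next_end_def rev_nth)
  qed
  moreover have "boundary_word (rg_edges B) (map across_end (rev L))"
  proof -
    have "inj across_end" by (metis across_end_across_end injI)
    then have mem: "y \<in> set (map across_end (rev L)) \<longleftrightarrow> across_end y \<in> set L" for y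
      by (metis across_end_across_end inj_image_mem_iff set_map set_rev)
    have word: "finite (rg_edges B)" "distinct L" "\<And>y. y \<in> set L \<Longrightarrow> fst y \<in> rg_edges B"
      "\<And>y. fst y \<in> rg_edges B \<Longrightarrow> (y \<in> set L) \<noteq> (across_end y \<in> set L)"
      using assms unfolding traces_def boundary_word_def by blast+
    have "distinct (map across_end (rev L))"
      using word(2) inj_on_subset[OF \<open>inj across_end\<close>] by (simp add: distinct_map)
    moreover have "fst y \<in> rg_edges B" if "y \<in> set (map across_end (rev L))" for y
      using that word(3)[of "across_end y"] unfolding mem by simp
    moreover have "(y \<in> set (map across_end (rev L))) \<noteq> (across_end y \<in> set (map across_end (rev L)))"
      if "fst y \<in> rg_edges B" for y
      unfolding mem across_end_across_end using word(4)[OF that] by blast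
    ultimately show ?thesis
      unfolding boundary_word_def using word(1) by blast
  qed
  ultimately show ?thesis using assms by (simp add: traces_def)
qed

lemma traces_rotate:
  assumes "traces B L"
  shows "traces B (rotate m L)"
proof -
  have "next_end B (rotate m L ! i) = rotate m L ! (Suc i mod length L)" if "i < length L" for i
  proof -
    have "(m + i) mod length L < length L"
      using that by (intro mod_less_divisor) auto
    then have "next_end B (rotate m L ! i) = L ! (Suc ((m + i) mod length L) mod length L)"
      using assms that by (simp add: nth_rotate traces_def)
    also have "Suc ((m + i) mod length L) mod length L = (m + Suc i mod length L) mod length L"
      by (simp add: mod_simps)
    also have "L ! \<dots> = rotate m L ! (Suc i mod length L)"
      using that by (intro nth_rotate[symmetric]) (auto intro: mod_less_divisor)
    finally show ?thesis .
  qed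
  moreover have "boundary_word (rg_edges B) (rotate m L)"
    using assms unfolding traces_def boundary_word_def distinct_rotate set_rotate by blast
  ultimately show ?thesis
    using assms unfolding traces_def length_rotate rotate_is_Nil_conv by blast
qed

lemma traces_funpow:
  assumes "traces B L" "i < length L"
  shows "(next_end B ^^ n) (L ! i) = L ! ((i + n) mod length L)"
proof (induction n)
  case (Suc n)
  have "(i + n) mod length L < length L" using assms by (intro mod_less_divisor) auto
  then have "next_end B (L ! ((i + n) mod length L)) = L ! (Suc ((i + n) mod length L) mod length L)"
    using assms(1) unfolding traces_def by blast
  then show ?case by (simp add: Suc.IH mod_Suc_eq)
qed (use assms in simp)

subsection \<open>The signed intersection graph in terms of the boundary word\<close>

definition alternating :: "'a \<Rightarrow> 'a \<Rightarrow> 'a list \<Rightarrow> bool" where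
  "alternating e f w \<longleftrightarrow> subseq [e, f, e, f] w \<or> subseq [f, e, f, e] w"

lemma alternating_commute: "alternating e f w \<longleftrightarrow> alternating f e w"
  by (auto simp: alternating_def)

lemma alternating_rotate1:
  assumes "alternating e f w"
  shows "alternating e f (rotate1 w)"
proof (cases w)
  case (Cons a t)
  \<comment> \<open>If the letter moved to the end starts the pattern \<open>x y x y\<close>, the
    remaining \<open>y x y\<close> and the moved letter form \<open>y x y x\<close>.\<close>
  have *: "alternating x y (t @ [a])" if "subseq [x, y, x, y] (a # t)" for x y
  proof (cases "x = a")
    case True
    then have "subseq [y, x, y] t" using that by simp
    then have "subseq ([y, x, y] @ [x]) (t @ [a])"
      using True by (intro list_emb_append_mono) auto
    then show ?thesis by (simp add: alternating_def)
  next
    case False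
    then have "subseq [x, y, x, y] t" using that by simp
    then show ?thesis unfolding alternating_def by (intro disjI1 subseq_rev_drop_many)
  qed
  show ?thesis
    using assms *[of e f] *[of f e] alternating_commute[of f e "t @ [a]"]
    unfolding Cons rotate1.simps alternating_def[of e f "a # t"] by blast
qed (use assms in simp)

lemma alternating_rotate: "alternating e f w \<Longrightarrow> alternating e f (rotate m w)"
  by (induction m) (auto intro: alternating_rotate1)

lemma subseq_rev: "subseq xs ys \<Longrightarrow> subseq (rev xs) (rev ys)"
  by (induction rule: list_emb.induct) (auto intro: subseq_rev_drop_many list_emb_append_mono)

lemma alternating_rev: "alternating e f w \<Longrightarrow> alternating e f (rev w)"
  unfolding alternating_def by (auto dest: subseq_rev)

lemma alternating_filter:
  assumes "P e" "P f"
  shows "alternating e f (filter P w) \<longleftrightarrow> alternating e f w"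
proof -
  have "subseq xs (filter P w) \<longleftrightarrow> subseq xs w" if "filter P xs = xs" for xs
    using that by (metis subseq_filter subseq_filter_left subseq_order.order_trans)
  then show ?thesis using assms by (simp add: alternating_def)
qed

text \<open>Greedy matching: the first \<open>e\<close> stands right after \<open>u\<close>, so all
  depends on whether \<open>f\<close> has been met before it.\<close>

lemma subseq_Cons_Cons_append_iff:
  assumes "e \<notin> set u" "f \<noteq> e"
  shows "subseq (f # e # xs) (u @ e # r) \<longleftrightarrow>
    (if f \<in> set u then subseq xs r else subseq (f # e # xs) r)"
proof -
  have "subseq (e # xs) (u @ e # r) \<longleftrightarrow> subseq xs r" if "e \<notin> set u" for u
    using that by (induction u) auto
  then show ?thesis using assms by (induction u) auto
qed

text \<open>With both occurrences of \<open>e\<close> displayed, alternation means that exactly one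
  of the two occurrences of \<open>f\<close> lies between them. This parity opens interlacement to
  linear algebra over GF(2).\<close>

lemma alternating_iff_odd:
  assumes "e \<notin> set u" "e \<notin> set m" "e \<notin> set t" "f \<noteq> e"
    and "count_list (u @ e # m @ e # t) f = 2"
  shows "alternating e f (u @ e # m @ e # t) \<longleftrightarrow> odd (count_list m f)"
proof -
  have skip: "subseq (e # xs) (u @ e # r) \<longleftrightarrow> subseq xs r" for xs r
    using assms(1) by (induction u) auto
  have no: "\<not> subseq (f # e # xs) t" for xs
    using assms(3) by (auto dest!: subseq_Cons' list_emb_ConsD)
  have "alternating e f (u @ e # m @ e # t) \<longleftrightarrow>
      f \<in> set m \<and> (f \<in> set t \<or> f \<in> set u)"
    unfolding alternating_def skip using assms(1,2,4) no
    by (simp add: subseq_Cons_Cons_append_iff subseq_singleton_left)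
  also have "\<dots> \<longleftrightarrow> count_list m f \<noteq> 0 \<and> (count_list t f \<noteq> 0 \<or> count_list u f \<noteq> 0)"
    by (simp add: count_list_0_iff)
  also have "\<dots> \<longleftrightarrow> odd (count_list m f)"
  proof -
    have "count_list u f + count_list m f + count_list t f = 2"
      using assms(4,5) by simp
    then show ?thesis by presburger
  qed
  finally show ?thesis .
qed

text \<open>Builds a subsequence from increasing positions, one letter at a time from the
  right.\<close>

lemma nth_subseq_drop:
  assumes "n \<le> i" "i < length w" "subseq xs (drop (Suc i) w)"
  shows "subseq (w ! i # xs) (drop n w)"
proof -
  have "drop n w = take (i - n) (drop n w) @ drop i w"
    using assms(1) by (metis append_take_drop_id drop_drop le_add_diff_inverse2)
  also have "drop i w = w ! i # drop (Suc i) w"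
    using assms(2) by (simp add: Cons_nth_drop_Suc)
  finally show ?thesis
    using assms(3) by (metis list_emb_append2 subseq_Cons2)
qed

text \<open>The walk in \<open>interlaced\<close> may start at any corner, in either direction. If
  \<open>x\<close> is a letter, a rotation brings it to the front; otherwise its partner is a
  letter, and the direction is reversed first.\<close>

lemma traces_start:
  assumes "traces B L" "x \<in> corners B"
  obtains L' where "traces B L'" "length L' = length L" "0 < length L" "L' ! 0 = x"
    "\<And>e f. alternating e f (map fst L') \<Longrightarrow> alternating e f (map fst L)"
proof -
  note obt = that
  have *: thesis if L1: "traces B L1" "length L1 = length L" "x \<in> set L1"
    "\<And>e f. alternating e f (map fst L1) \<Longrightarrow> alternating e f (map fst L)" for L1
  proof -
    obtain i where i: "i < length L1" "x = L1 ! i" using L1(3) by (metis in_set_conv_nth)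
    show thesis
    proof (rule obt)
      show "traces B (rotate i L1)" using L1(1) by (rule traces_rotate)
      show "length (rotate i L1) = length L" by (simp add: L1)
      show "0 < length L" using i L1 by auto
      have "0 < length L1" using i by auto
      then show "rotate i L1 ! 0 = x" using i by (simp add: nth_rotate)
      \<comment> \<open>Rotating on to the full length restores \<open>L1\<close>, so alternation
        can be carried back.\<close>
      have undo: "rotate (length L1 - i) (map fst (rotate i L1)) = map fst L1"
        using i by (simp add: rotate_map rotate_rotate)
      fix e f assume "alternating e f (map fst (rotate i L1))"
      then show "alternating e f (map fst L)"
        using L1(4) alternating_rotate undo by metis
    qed
  qed
  show thesis
  proof (cases "x \<in> set L")
    case True
    then show ?thesis using assms by (intro *[of L]) auto
  next
    case False
    then have "across_end x \<in> set L"
      using assms across_end_in_boundary_word unfolding traces_def in_corners_iff by blast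
    then have "x \<in> set (map across_end (rev L))"
      by (metis across_end_across_end image_eqI set_map set_rev)
    moreover have "map fst (map across_end (rev L)) = rev (map fst L)"
      by (simp add: rev_map comp_def)
    ultimately show ?thesis using assms
      by (intro *[of "map across_end (rev L)"] traces_rev) (auto dest: alternating_rev)
  qed
qed

lemma interlaced_iff:
  assumes "traces B L"
  shows "interlaced B e f \<longleftrightarrow> alternating e f (map fst L)"
proof
  have N: "2 * card (rg_edges B) = length L"
    using assms length_boundary_word unfolding traces_def by metis
  {
    assume "interlaced B e f"
    then obtain x i j k where x: "x \<in> corners B" "0 < i" "i < j" "j < k" "k < length L"
      "fst x = e" "fst ((next_end B ^^ i) x) = f" "fst ((next_end B ^^ j) x) = e"
      "fst ((next_end B ^^ k) x) = f"
      unfolding interlaced_def N by blast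
    obtain L' where L': "traces B L'" "length L' = length L" "0 < length L" "L' ! 0 = x"
      "\<And>e f. alternating e f (map fst L') \<Longrightarrow> alternating e f (map fst L)"
      using assms x(1) by (rule traces_start) blast
    define w where "w = map fst L'"
    have w: "w ! n = fst ((next_end B ^^ n) x)" if "n < length L" for n
      using traces_funpow[OF L'(1), of 0 n] that L' by (simp add: w_def)
    have len: "length w = length L" by (simp add: w_def L')
    have "subseq [w ! 0, w ! i, w ! j, w ! k] (drop 0 w)"
      by (intro nth_subseq_drop list_emb_Nil) (use x len in auto)
    then have "subseq [e, f, e, f] w" using x L'(3) w[of 0] by (simp add: w)
    then show "alternating e f (map fst L)" by (intro L'(5)) (simp add: alternating_def w_def)
  }
  \<comment> \<open>Conversely, start at the letter of the first \<open>x\<close>; the other three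
    letters are reached after \<open>?i\<close>, \<open>?j\<close> and \<open>?k\<close>
    steps.\<close>
  have *: "interlaced B x y" if L1: "traces B L1" "subseq [x, y, x, y] (map fst L1)" for L1 x y
  proof -
    obtain u s t v r where w: "map fst L1 = u @ x # s @ y # t @ x # v @ y # r"
      using L1(2) by (auto dest!: list_emb_ConsD)
    let ?w = "map fst L1"
    let ?p = "length u" and ?i = "Suc (length s)" and ?j = "length s + length t + 2"
      and ?k = "length s + length t + length v + 3"
    have len: "length L1 = ?p + ?k + Suc (length r)"
      using arg_cong[OF w, of length] by simp
    have N1: "2 * card (rg_edges B) = length L1"
      using L1 length_boundary_word unfolding traces_def by metis
    have fw: "fst ((next_end B ^^ n) (L1 ! ?p)) = ?w ! (?p + n)" if "?p + n < length L1" for n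
      using that traces_funpow[OF L1(1), of ?p n] by simp
    have "L1 ! ?p \<in> corners B"
      using L1(1) len by (intro nth_in_corners) auto
    moreover have "fst (L1 ! ?p) = x" "?w ! (?p + ?i) = y" "?w ! (?p + ?j) = x" "?w ! (?p + ?k) = y"
      using fw[of 0] len by (simp_all add: w nth_append)
    ultimately show ?thesis
      unfolding interlaced_def N1
      by (intro exI[of _ "L1 ! ?p"] exI[of _ ?i] exI[of _ ?j] exI[of _ ?k])
        (simp add: fw len del: funpow.simps nth_map)
  qed
  assume "alternating e f (map fst L)"
  then consider "subseq [e, f, e, f] (map fst L)" | "subseq [f, e, f, e] (map fst L)"
    unfolding alternating_def by blast
  then show "interlaced B e f"
  proof cases
    case 1
    then show ?thesis using * assms by blast
  next
    case 2
    \<comment> \<open>Travelling backwards turns the second pattern into the first.\<close>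
    then have "subseq [e, f, e, f] (map fst (map across_end (rev L)))"
      by (auto dest: subseq_rev simp: rev_map[symmetric] comp_def)
    then show ?thesis using * traces_rev[OF assms] by blast
  qed
qed

text \<open>The walk from a corner meets exactly the letters of the word for its direction of
  travel: \<open>L\<close>, or the reversed word, whose letters are the corners missing from
  \<open>L\<close>. So both corners must belong to the same one of these two words.\<close>

lemma twisted_iff:
  assumes "traces B L" "e \<in> rg_edges B"
  shows "twisted B e \<longleftrightarrow> ((e, False, False) \<in> set L \<longleftrightarrow> (e, True, False) \<in> set L)"
proof -
  have reach: "y \<in> set L1 \<longleftrightarrow> (\<exists>n. (next_end B ^^ n) x = y)" if L1: "traces B L1" "x \<in> set L1" for L1 x y
  proof -
    obtain i where i: "i < length L1" "L1 ! i = x" using L1(2) by (metis in_set_conv_nth)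
    show ?thesis
    proof
      assume "y \<in> set L1"
      then obtain j where j: "j < length L1" "L1 ! j = y" by (metis in_set_conv_nth)
      have "(i + (length L1 - i + j)) mod length L1 = j" using i j by simp
      then have "(next_end B ^^ (length L1 - i + j)) x = y"
        using traces_funpow[OF L1(1) i(1), of "length L1 - i + j"] unfolding i(2) j(2)
        by (simp only: j(2))
      then show "\<exists>n. (next_end B ^^ n) x = y" ..
    next
      assume "\<exists>n. (next_end B ^^ n) x = y"
      then obtain n where "y = L1 ! ((i + n) mod length L1)"
        using traces_funpow[OF L1(1) i(1)] unfolding i(2) by metis
      then show "y \<in> set L1" using i by (auto intro!: nth_mem mod_less_divisor)
    qed
  qed
  have opp: "y \<in> set (map across_end (rev L)) \<longleftrightarrow> y \<notin> set L" if "fst y = e" for y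
  proof -
    have "y \<in> across_end ` set L \<longleftrightarrow> across_end y \<in> set L"
      by (metis across_end_across_end image_iff)
    then show ?thesis
      using across_end_in_boundary_word that assms unfolding traces_def set_map set_rev by blast
  qed
  show ?thesis
  proof (cases "(e, False, False) \<in> set L")
    case True
    then show ?thesis using reach[OF assms(1) True, of "(e, True, False)"]
      unfolding twisted_def by blast
  next
    case False
    then have "(e, False, False) \<in> set (map across_end (rev L))" using opp by simp
    then show ?thesis using reach[OF traces_rev[OF assms(1)], of "(e, False, False)" "(e, True, False)"]
        opp[of "(e, True, False)"] False
      unfolding twisted_def by (metis fst_conv)
  qed
qed

text \<open>The signed intersection graph read off a word without reference to a ribbon graph, so
  that deleting letters makes sense before a smaller bouquet is available.\<close>

definition word_graph :: "'e set \<Rightarrow> 'e corner list \<Rightarrow> 'e signed_graph" where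
  "word_graph E L =
     \<lparr>sg_verts = E,
      sg_edges = {{e, f} |e f. e \<in> E \<and> f \<in> E \<and> e \<noteq> f \<and> alternating e f (map fst L)},
      sg_pos = {e \<in> E. (e, False, False) \<in> set L \<longleftrightarrow> (e, True, False) \<notin> set L}\<rparr>"

lemma SI_eq_word_graph:
  assumes "traces B L"
  shows "SI B = word_graph (rg_edges B) L"
  unfolding SI_def word_graph_def interlaced_iff[OF assms] using twisted_iff[OF assms] by auto

lemma delete_vertex_word_graph:
  "delete_vertex (word_graph E L) v = word_graph (E - {v}) (filter (\<lambda>y. fst y \<noteq> v) L)"
proof -
  have "map fst (filter (\<lambda>y. fst y \<noteq> v) L) = filter (\<lambda>e. e \<noteq> v) (map fst L)"
    by (simp add: filter_map comp_def)
  then have "alternating e f (map fst (filter (\<lambda>y. fst y \<noteq> v) L)) \<longleftrightarrow> alternating e f (map fst L)"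
    if "e \<noteq> v" "f \<noteq> v" for e f
    using that by (simp add: alternating_filter)
  then have alt: "{{e, f} |e f. e \<in> E - {v} \<and> f \<in> E - {v} \<and> e \<noteq> f \<and>
        alternating e f (map fst (filter (\<lambda>y. fst y \<noteq> v) L))} =
      {{e, f} |e f. e \<in> E - {v} \<and> f \<in> E - {v} \<and> e \<noteq> f \<and> alternating e f (map fst L)}"
    by blast
  have "{d \<in> {{e, f} |e f. e \<in> E \<and> f \<in> E \<and> e \<noteq> f \<and> alternating e f (map fst L)}. v \<notin> d} =
      {{e, f} |e f. e \<in> E - {v} \<and> f \<in> E - {v} \<and> e \<noteq> f \<and> alternating e f (map fst L)}"
    by blast
  then show ?thesis
    unfolding delete_vertex_def word_graph_def alt by auto
qed

section \<open>Passing between boundary words and bouquets\<close>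

text \<open>The arcs are dictated by the word: each joins the far corner of one ribbon end to the
  letter that follows cyclically.\<close>

lemma traces_exists:
  assumes L: "boundary_word E L"
  obtains B where "traces B L" "rg_edges B = E"
proof -
  have "finite E" "distinct L" using L unfolding boundary_word_def by blast+
  define P where "P = zip (map across_end L) (rotate1 L)"
  define Q where "Q = P @ map (\<lambda>(a, b). (b, a)) P"
  define B where "B = \<lparr>rg_edges = E, rg_arc = (\<lambda>y. the (map_of Q y)),
    rg_isolated = (if L = [] then 1 else 0)\<rparr>"
  have "map fst P = map across_end L" "map snd P = rotate1 L"
    by (simp_all add: P_def)
  then have keys: "map fst Q = map across_end L @ rotate1 L"
    by (simp add: Q_def split_beta comp_def)
  have disj: "across_end y \<notin> set L" if "y \<in> set L" for y
    using that L across_end_in_boundary_word fst_in_boundary_word by metis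
  have "inj_on across_end (set L)" by (metis across_end_across_end inj_onI)
  then have distinct: "distinct (map fst Q)"
    unfolding keys using \<open>distinct L\<close> disj by (auto simp: distinct_map)
  have arc: "rg_arc B y = z" if "(y, z) \<in> set Q" for y z
    using map_of_is_SomeI[OF distinct that] by (simp add: B_def)
  have sym: "(z, y) \<in> set Q" if "(y, z) \<in> set Q" for y z
    using that by (auto simp: Q_def)
  have key_iff: "y \<in> fst ` set Q \<longleftrightarrow> fst y \<in> E" for y
  proof -
    have "fst ` set Q = across_end ` set L \<union> set L"
      by (metis keys list.set_map set_append set_rotate1)
    then show ?thesis
      using L across_end_in_boundary_word fst_in_boundary_word
      by (metis Un_iff across_end_across_end fst_across_end image_iff)
  qed
  have "ribbon_graph B"
    unfolding ribbon_graph_def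
  proof (intro conjI ballI)
    show "finite (rg_edges B)" using \<open>finite E\<close> by (simp add: B_def)
    fix y assume "y \<in> corners B"
    then have "y \<in> fst ` set Q" by (simp add: key_iff in_corners_iff B_def)
    then obtain z where z: "(y, z) \<in> set Q" by auto
    then have "z \<in> fst ` set Q" using sym[OF z] by force
    then have "z \<in> corners B" by (simp add: key_iff in_corners_iff B_def)
    moreover have "y \<noteq> z"
    proof
      assume "y = z"
      then have "(y, y) \<in> set P" using z by (auto simp: Q_def)
      then have "y \<in> across_end ` set L" "y \<in> set L"
        unfolding P_def by (auto dest: set_zip_leftD set_zip_rightD)
      then show False using disj by auto
    qed
    ultimately show "rg_arc B y \<in> corners B" "rg_arc B y \<noteq> y" "rg_arc B (rg_arc B y) = y"
      using arc[OF z] arc[OF sym[OF z]] by auto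
  qed
  moreover have "next_end B (L ! i) = L ! (Suc i mod length L)" if "i < length L" for i
  proof -
    have "(across_end (L ! i), L ! (Suc i mod length L)) \<in> set P"
    proof -
      have "P ! i \<in> set P" using that by (intro nth_mem) (simp add: P_def)
      moreover have "P ! i = (across_end (L ! i), L ! (Suc i mod length L))"
        using that by (simp add: P_def nth_rotate1)
      ultimately show ?thesis by simp
    qed
    then show ?thesis unfolding next_end_def by (intro arc) (simp add: Q_def)
  qed
  ultimately have "traces B L"
    unfolding traces_def using L by (simp add: B_def)
  then show thesis by (rule that) (simp add: B_def)
qed

text \<open>
  Both walks around the vertex, one per direction, are disjoint: otherwise an alternating product of
  the two fixed-point-free involutions would reduce to one of them having a fixed point.
\<close>

lemma across_end_neq_funpow_next_end:
  assumes "ribbon_graph B" "y \<in> corners B"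
  shows "across_end y \<noteq> (next_end B ^^ k) y"
  using assms(2)
proof (induction k arbitrary: y rule: less_induct)
  case (less k)
  have across: "across_end y \<in> corners B" using less.prems by (simp add: in_corners_iff)
  consider "k = 0" | "k = 1" | k' where "k = Suc (Suc k')"
    by (metis One_nat_def not0_implies_Suc)
  then show ?case
  proof cases
    case 2
    then show ?thesis
      using assms(1) across by (auto simp: ribbon_graph_def next_end_def)
  next
    case 3
    \<comment> \<open>Cancelling the first and the last step leaves the same equation for
      \<open>z\<close>, with two steps fewer.\<close>
    define z where "z = next_end B y"
    have z: "z \<in> corners B" "rg_arc B z = across_end y"
      using assms(1) across by (auto simp: ribbon_graph_def next_end_def z_def)
    show ?thesis
    proof
      assume "across_end y = (next_end B ^^ k) y"
      also have "\<dots> = next_end B ((next_end B ^^ k') z)"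
        by (simp add: 3 z_def funpow_swap1)
      finally have "rg_arc B (across_end y) = rg_arc B (rg_arc B (across_end ((next_end B ^^ k') z)))"
        by (simp add: next_end_def)
      moreover have "rg_arc B (across_end y) = z" by (simp add: z_def next_end_def)
      moreover have "(next_end B ^^ n) z \<in> corners B" for n
        using z(1) assms(1) by (induction n) (auto simp: ribbon_graph_def next_end_def in_corners_iff)
      then have "across_end ((next_end B ^^ k') z) \<in> corners B"
        by (simp add: in_corners_iff)
      ultimately have "z = across_end ((next_end B ^^ k') z)"
        using assms(1) by (simp add: ribbon_graph_def)
      then have "across_end z = (next_end B ^^ k') z" by (metis across_end_across_end)
      then show False using less.IH[of k' z] z(1) 3 by simp
    qed
  qed simp
qed

text \<open>The word is one period of the walk from any corner. As there is only one vertex, the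
  corners met and their partners exhaust all corners.\<close>

lemma bouquet_traces:
  assumes "bouquet B"
  obtains L where "traces B L"
proof (cases "corners B = {}")
  case True
  then have "rg_edges B = {}" by (auto simp: corners_def)
  moreover have "rg_isolated B = 1"
    using assms True by (simp add: bouquet_def num_vertices_def orbits_def)
  ultimately have "traces B []"
    using assms by (simp add: bouquet_def traces_def boundary_word_def)
  then show thesis by (rule that)
next
  case False
  then obtain x0 where x0: "x0 \<in> corners B" by blast
  have rg: "ribbon_graph B" using assms by (simp add: bouquet_def)
  have fin: "finite (corners B)" using rg by (simp add: ribbon_graph_def corners_def)
  define s where "s = next_end B"
  define p where "p n = (s ^^ n) x0" for n
  have p_add: "p (m + n) = (s ^^ m) (p n)" for m n
    by (simp add: p_def funpow_add)
  have arc: "rg_arc B y \<in> corners B" "rg_arc B (rg_arc B y) = y" if "y \<in> corners B" for y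
    using rg that by (auto simp: ribbon_graph_def)
  have p_in: "p n \<in> corners B" for n
  proof (induction n)
    case (Suc n)
    then have "across_end (p n) \<in> corners B" by (simp add: in_corners_iff)
    then show ?case using arc by (simp add: p_def s_def next_end_def)
  qed (simp add: p_def x0)
  \<comment> \<open>Steps can be undone, so the walk is purely periodic: its first repetition is a
    return to the start.\<close>
  have pred: "across_end (rg_arc B (p (Suc n))) = p n" for n
    using arc[of "across_end (p n)"] p_in[of n] by (simp add: p_def s_def next_end_def in_corners_iff)
  have cancel: "p (j + k) = p j \<Longrightarrow> p k = p 0" for j k
    by (induction j) (use pred in \<open>auto, metis\<close>)
  have "\<not> inj p"
    using fin p_in by (metis finite_imageD finite_subset image_subsetI infinite_UNIV_nat)
  then obtain i j where "i < j" "p i = p j" by (metis injI linorder_neqE_nat)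
  then have "0 < j - i \<and> p (j - i) = p 0"
    using cancel[of i "j - i"] by simp
  define N where "N = (LEAST n. 0 < n \<and> p n = p 0)"
  have N: "0 < N" "p N = p 0"
    using LeastI[of "\<lambda>n. 0 < n \<and> p n = p 0"] \<open>0 < j - i \<and> p (j - i) = p 0\<close>
    unfolding N_def by blast+
  have N_least: "N \<le> n" if "0 < n" "p n = p 0" for n
    unfolding N_def using that by (simp add: Least_le)
  have p_mod: "p (n mod N) = p n" for n
    using funpow_mod_eq[of N s x0 n] N(2) by (simp add: p_def)
  define L where "L = map p [0..<N]"
  have mem_L: "p n \<in> set L" for n
  proof -
    have "p (n mod N) \<in> set L" using N(1) by (simp add: L_def)
    then show ?thesis by (simp add: p_mod)
  qed
  have L_p: "\<exists>n. y = p n" if "y \<in> set L" for y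
    using that by (auto simp: L_def)
  have "inj_on p {..<N}"
  proof (rule linorder_inj_onI')
    fix i j assume "i \<in> {..<N}" "j \<in> {..<N}" "i < j"
    then show "p i \<noteq> p j" using cancel[of i "j - i"] N_least[of "j - i"] by auto
  qed
  then have distinct: "distinct L" by (simp add: L_def distinct_map atLeast0LessThan)
  have disj: "across_end y \<notin> set L" if y: "y \<in> set L" for y
  proof
    assume "across_end y \<in> set L"
    then obtain j where j: "across_end y = p j" using L_p by blast
    obtain i where i: "i < N" "y = p i" using y by (auto simp: L_def)
    \<comment> \<open>Going on from position \<open>i\<close> to the end of the period and then to
      \<open>j\<close> would lead from \<open>y\<close> to its partner.\<close>
    have "(s ^^ (j + (N - i))) y = p (j + N)"
      using i p_add[of "j + (N - i)" i] by simp
    also have "\<dots> = p j" by (metis mod_add_self2 p_mod)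
    finally show False
      using across_end_neq_funpow_next_end[OF rg, of y "j + (N - i)"] p_in i j by (simp add: s_def)
  qed
  define R where "R = {(x, y). x \<in> corners B \<and> (y = rg_arc B x \<or> y = across_end x)}"
  have orbits: "orbits (corners B) (rg_arc B) across_end = (\<lambda>x. R\<^sup>* `` {x}) ` corners B"
    by (auto simp: orbits_def R_def quotient_def)
  have "card ((\<lambda>x. R\<^sup>* `` {x}) ` corners B) \<noteq> 0"
    using x0 fin by auto
  then have iso: "rg_isolated B = 0" and one: "card ((\<lambda>x. R\<^sup>* `` {x}) ` corners B) = 1"
    using assms by (auto simp: bouquet_def num_vertices_def orbits)
  have reach: "(x0, y) \<in> R\<^sup>*" if "y \<in> corners B" for y
  proof -
    obtain C where C: "(\<lambda>x. R\<^sup>* `` {x}) ` corners B = {C}"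
      using one by (rule card_1_singletonE)
    have "R\<^sup>* `` {z} \<in> {C}" if "z \<in> corners B" for z
      unfolding C[symmetric] using that by (rule imageI)
    from this[OF that] this[OF x0] have "R\<^sup>* `` {y} = R\<^sup>* `` {x0}" by simp
    moreover have "y \<in> R\<^sup>* `` {y}" by blast
    ultimately have "y \<in> R\<^sup>* `` {x0}" by simp
    then show ?thesis by blast
  qed
  \<comment> \<open>Letters and partners of letters together are closed under both
    involutions.\<close>
  have "y \<in> set L \<or> across_end y \<in> set L" if "(x0, y) \<in> R\<^sup>*" for y
    using that
  proof induction
    case base
    have "x0 = p 0" by (simp add: p_def)
    then show ?case using mem_L by blast
  next
    case (step y z)
    then consider "z = rg_arc B y" "y \<in> set L" | "z = rg_arc B y" "across_end y \<in> set L"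
      | "z = across_end y" by (auto simp: R_def)
    then show ?case
    proof cases
      case 1
      then obtain n where "y = p n" using L_p by blast
      \<comment> \<open>Adding a period provides a predecessor index also for
        \<open>n = 0\<close>.\<close>
      then have "y = p (Suc (n + N - 1))"
        using N(1) by simp (metis mod_add_self2 p_mod)
      then have "across_end z = p (n + N - 1)" using pred 1 by metis
      then show ?thesis using mem_L by metis
    next
      case 2
      then obtain n where "across_end y = p n" using L_p by blast
      then have "z = p (Suc n)" using 2
        by (metis across_end_across_end comp_apply funpow.simps(2) next_end_def p_def s_def)
      then show ?thesis using mem_L by blast
    next
      case 3
      then show ?thesis using step.IH by auto
    qed
  qed
  then have cover: "y \<in> set L \<or> across_end y \<in> set L" if "fst y \<in> rg_edges B" for y
    using reach that by (simp add: in_corners_iff)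
  have "\<forall>y\<in>set L. fst y \<in> rg_edges B" using L_p p_in in_corners_iff by metis
  then have "boundary_word (rg_edges B) L"
    using rg distinct disj cover unfolding boundary_word_def ribbon_graph_def by metis
  moreover have "next_end B (L ! i) = L ! (Suc i mod length L)" if "i < length L" for i
  proof -
    have "next_end B (L ! i) = p (Suc i)" using that by (simp add: L_def p_def s_def)
    also have "\<dots> = L ! (Suc i mod length L)" using N(1) by (simp add: L_def p_mod)
    finally show ?thesis .
  qed
  ultimately have "traces B L"
    unfolding traces_def using rg iso N(1) by (auto simp: L_def)
  then show thesis by (rule that)
qed

subsection \<open>Boundary components and the kernel of the adjacency matrix\<close>

text \<open>
  A vector over \<open>GF(2)\<close> indexed by \<open>A\<close> is represented by its support \<open>x\<close>; a negative sign stands for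
  a diagonal entry 1 of the adjacency matrix.
\<close>

definition nullspace :: "'e signed_graph \<Rightarrow> 'e set \<Rightarrow> 'e set set" where
  "nullspace SG A = {x. x \<subseteq> A \<and>
     (\<forall>e\<in>A. odd (card {f \<in> x. {e, f} \<in> sg_edges SG}) \<longleftrightarrow> e \<in> x \<and> e \<notin> sg_pos SG)}"

text \<open>Summation along the walk: a GF(2) function that changes exactly at the ends of edges in
  \<open>x\<close> differs from its initial value by the crossing parity of the prefix read so
  far.\<close>

definition crossing_parity :: "'e set \<Rightarrow> 'e corner list \<Rightarrow> bool" where
  "crossing_parity x L \<longleftrightarrow> odd (length (filter (\<lambda>y. fst y \<in> x) L))"

lemma length_filter_mem:
  assumes "finite x"
  shows "length (filter (\<lambda>y. fst y \<in> x) L) = (\<Sum>f\<in>x. count_list (map fst L) f)"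
proof (induction L)
  case (Cons a L)
  have "(\<Sum>f\<in>x. count_list (map fst (a # L)) f) =
    (\<Sum>f\<in>x. (if fst a = f then 1 else 0) + count_list (map fst L) f)"
    by (intro sum.cong) auto
  then show ?case
    using Cons assms by (simp add: sum.distrib)
qed simp

text \<open>Every label occurs twice, so such a function closes up after a full turn.\<close>

lemma crossing_parity_boundary_word:
  assumes "boundary_word E L" "x \<subseteq> E"
  shows "\<not> crossing_parity x L"
proof -
  have "finite x"
    using assms finite_subset unfolding boundary_word_def by blast
  moreover have "(\<Sum>f\<in>x. count_list (map fst L) f) = (\<Sum>f\<in>x. 2)"
    using assms(2) by (intro sum.cong refl count_list_boundary_word[OF assms(1)]) auto
  ultimately show ?thesis
    by (simp add: crossing_parity_def length_filter_mem)
qed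

lemma crossing_parity_take_Suc:
  assumes "i < length L"
  shows "crossing_parity x (take (Suc i) L) \<longleftrightarrow>
    crossing_parity x (take i L) \<noteq> (fst (L ! i) \<in> x)"
  using assms by (simp add: crossing_parity_def take_Suc_conv_app_nth)

text \<open>
  Invariance of \<open>h\<close> under the sides of \<open>e\<close> compares \<open>h\<close> at the two ends of \<open>e\<close>; between them, \<open>h\<close> changes
  once for every letter of the word with label in \<open>x\<close>, and the labels that occur there an odd number
  of times are \<open>e\<close> itself and the edges interlaced with \<open>e\<close>. This is row \<open>e\<close> of the linear system.
\<close>

lemma along_side_invariant_iff:
  assumes L: "boundary_word E L" and "e \<in> E" "x \<subseteq> E"
    and h1: "\<And>i. i < length L \<Longrightarrow> L ! i \<in> h \<longleftrightarrow> c \<noteq> crossing_parity x (take i L)"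
    and h2: "\<And>i. i < length L \<Longrightarrow>
      across_end (L ! i) \<in> h \<longleftrightarrow> c \<noteq> crossing_parity x (take (Suc i) L)"
  shows "(\<forall>i j. (e, i, j) \<in> h \<longleftrightarrow> (e, \<not> i, j) \<in> h) \<longleftrightarrow>
    (odd (card {f \<in> x. {e, f} \<in> sg_edges (word_graph E L)}) \<longleftrightarrow>
      e \<in> x \<and> e \<notin> sg_pos (word_graph E L))"
proof -
  have fin: "finite x"
    using assms(1,3) finite_subset unfolding boundary_word_def by blast
  have distinct: "distinct L" using L unfolding boundary_word_def by blast
  obtain j0 j1 where ends: "{y \<in> set L. fst y = e} = {(e, False, j0), (e, True, j1)}"
    using assms(1,2) by (rule boundary_word_two_ends)
  \<comment> \<open>Cut the word at the two ends of \<open>e\<close>; \<open>b\<close> tells which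
    end comes first.\<close>
  obtain b j k u m t where split: "L = u @ (e, b, j) # m @ (e, \<not> b, k) # t"
    and jk: "j0 = (if b then k else j)" "j1 = (if b then j else k)"
  proof -
    have "(e, False, j0) \<in> set L" "(e, True, j1) \<in> set L" using ends by blast+
    then obtain u r where r: "L = u @ (e, False, j0) # r" by (meson split_list)
    with \<open>(e, True, j1) \<in> set L\<close> have "(e, True, j1) \<in> set u \<union> set r" by simp
    show thesis
    proof (cases "(e, True, j1) \<in> set u")
      case True
      then obtain u' m' where "u = u' @ (e, True, j1) # m'" by (auto dest: split_list)
      then show thesis using r by (intro that[of u' True j1 m' j0 r]) auto
    next
      case False
      then obtain m' t' where "r = m' @ (e, True, j1) # t'"
        using \<open>(e, True, j1) \<in> set u \<union> set r\<close> by (auto dest: split_list)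
      then show thesis using r by (intro that[of u False j0 m' j1 t']) auto
    qed
  qed
  have only: "e \<notin> fst ` (set u \<union> set m \<union> set t)"
  proof
    assume "e \<in> fst ` (set u \<union> set m \<union> set t)"
    then obtain y where y: "y \<in> set u \<union> set m \<union> set t" "fst y = e" by auto
    then have "y \<in> {(e, False, j0), (e, True, j1)}"
      unfolding ends[symmetric] using split by auto
    then have "y = (e, b, j) \<or> y = (e, \<not> b, k)" using jk by (cases b) auto
    then show False using y(1) distinct split by auto
  qed
  define p where "p = length u"
  define q where "q = length u + Suc (length m)"
  have pq: "p < length L" "q < length L" "L ! p = (e, b, j)" "L ! q = (e, \<not> b, k)"
    by (auto simp: p_def q_def split nth_append)
  have take: "take p L = u" "take q L = u @ (e, b, j) # m"
    by (auto simp: p_def q_def split)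
  have adj: "{e, f} \<in> sg_edges (word_graph E L) \<longleftrightarrow> odd (count_list (map fst m) f)" if "f \<in> x" for f
  proof (cases "f = e")
    case True
    have "count_list (map fst m) e = 0" using only by (auto simp: count_list_0_iff)
    then show ?thesis using True by (auto simp: word_graph_def doubleton_eq_iff)
  next
    case False
    have "f \<in> E" using that assms(3) by blast
    then have "{e, f} \<in> sg_edges (word_graph E L) \<longleftrightarrow> alternating e f (map fst L)"
      using False \<open>e \<in> E\<close> by (auto simp: word_graph_def doubleton_eq_iff alternating_commute)
    also have "\<dots> \<longleftrightarrow> odd (count_list (map fst m) f)"
      using only False count_list_boundary_word[OF L \<open>f \<in> E\<close>]
        alternating_iff_odd[of e "map fst u" "map fst m" "map fst t" f]
      by (simp add: split image_Un)
    finally show ?thesis .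
  qed
  have "crossing_parity x m \<longleftrightarrow> odd (card {f \<in> x. {e, f} \<in> sg_edges (word_graph E L)})"
    using fin adj by (simp add: crossing_parity_def length_filter_mem even_sum_iff cong: conj_cong)
  moreover have "crossing_parity x (take q L) \<longleftrightarrow>
      crossing_parity x (take p L) \<noteq> ((e \<in> x) \<noteq> crossing_parity x m)"
    by (auto simp: take crossing_parity_def)
  \<comment> \<open>Sides join corners with equal third coordinate. For \<open>j \<noteq> k\<close>
    the walk between such corners crosses \<open>e\<close> itself never or twice, for
    \<open>j = k\<close> once; this produces the diagonal entry.\<close>
  moreover have "e \<in> sg_pos (word_graph E L) \<longleftrightarrow> j \<noteq> k"
  proof -
    have "(e, a, v) \<in> set L \<longleftrightarrow> (e, a, v) \<in> {(e, False, j0), (e, True, j1)}" for a v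
      unfolding ends[symmetric] by simp
    then have "(e, False, False) \<in> set L \<longleftrightarrow> \<not> j0" "(e, True, False) \<in> set L \<longleftrightarrow> \<not> j1"
      by auto
    then show ?thesis using \<open>e \<in> E\<close> jk by (auto simp: word_graph_def)
  qed
  moreover have "(e, b, j) \<in> h \<longleftrightarrow> c \<noteq> crossing_parity x (take p L)"
    "(e, \<not> b, k) \<in> h \<longleftrightarrow> c \<noteq> crossing_parity x (take q L)"
    "(e, b, \<not> j) \<in> h \<longleftrightarrow> c \<noteq> (crossing_parity x (take p L) \<noteq> (e \<in> x))"
    "(e, \<not> b, \<not> k) \<in> h \<longleftrightarrow> c \<noteq> (crossing_parity x (take q L) \<noteq> (e \<in> x))"
    using h1[OF pq(1)] h1[OF pq(2)] h2[OF pq(1)] h2[OF pq(2)] pq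
    by (simp_all add: crossing_parity_take_Suc)
  moreover have "(\<forall>i j. (e, i, j) \<in> h \<longleftrightarrow> (e, \<not> i, j) \<in> h) \<longleftrightarrow>
      ((e, False, False) \<in> h \<longleftrightarrow> (e, True, False) \<in> h) \<and>
      ((e, False, True) \<in> h \<longleftrightarrow> (e, True, True) \<in> h)"
    by (auto simp: all_bool_eq)
  ultimately show ?thesis
    by (cases b; cases j; cases k; simp; argo)
qed

text \<open>Arcs force the prefix-parity form of an invariant set, ends of edges outside
  \<open>A\<close> forbid changes there, and sides of edges in \<open>A\<close> give the rows of the
  system. The factor 2 is the free value at the base point.\<close>

lemma power_num_subgraph_boundaries:
  assumes "traces B L" "A \<subseteq> rg_edges B"
  shows "2 ^ num_subgraph_boundaries B A = 2 * card (nullspace (SI B) A)"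
proof (cases "L = []")
  case True
  have L: "boundary_word (rg_edges B) L" using assms unfolding traces_def by blast
  have "finite (rg_edges B)" using L unfolding boundary_word_def by blast
  then have "rg_edges B = {}" using length_boundary_word[OF L] True by simp
  then have "A = {}" "corners B = {}" using assms by (auto simp: corners_def)
  moreover have "rg_isolated B = 1" using assms True by (simp add: traces_def)
  moreover have "nullspace (SI B) {} = {{}}" by (auto simp: nullspace_def)
  ultimately show ?thesis by (simp add: num_subgraph_boundaries_def orbits_def)
next
  case False
  let ?E = "rg_edges B" and ?N = "length L"
  let ?g = "\<lambda>y. if fst y \<in> A then along_side y else across_end y"
  let ?cp = "\<lambda>x i. crossing_parity x (take i L)"
  have L: "boundary_word ?E L" and rg: "ribbon_graph B" and iso: "rg_isolated B = 0"
    and step: "\<And>i. i < ?N \<Longrightarrow> rg_arc B (across_end (L ! i)) = L ! (Suc i mod ?N)"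
    using assms False by (auto simp: traces_def next_end_def)
  have distinct: "distinct L" using L unfolding boundary_word_def by blast
  have arc: "rg_arc B y \<in> corners B" "rg_arc B (rg_arc B y) = y" if "y \<in> corners B" for y
    using rg that by (auto simp: ribbon_graph_def)
  have N: "0 < ?N" using False by simp
  have in_corners: "L ! i \<in> corners B" "across_end (L ! i) \<in> corners B" if "i < ?N" for i
    using nth_in_corners[OF assms(1) that] by (simp_all add: in_corners_iff)
  have corner_cases: "\<exists>i<?N. y = L ! i \<or> y = across_end (L ! i)" if "y \<in> corners B" for y
  proof -
    have "y \<in> set L \<or> across_end y \<in> set L"
      using that across_end_in_boundary_word[OF L] by (auto simp: in_corners_iff)
    then show ?thesis by (metis across_end_across_end in_set_conv_nth)
  qed
  define Inv where "Inv = {h. h \<subseteq> corners B \<and>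
    (\<forall>y\<in>corners B. (rg_arc B y \<in> h \<longleftrightarrow> y \<in> h) \<and> (?g y \<in> h \<longleftrightarrow> y \<in> h))}"
  \<comment> \<open>Testing the end \<open>False\<close> suffices: the sides force the same change
    at the other end.\<close>
  define coords where "coords h = (L ! 0 \<in> h, {e \<in> A. ((e, False, False) \<in> h) \<noteq> ((e, False, True) \<in> h)})"
    for h
  \<comment> \<open>The far corner of letter \<open>i\<close> comes after the crossing, hence the
    prefix of length \<open>Suc i\<close>.\<close>
  define of_coords where "of_coords = (\<lambda>(c, x). {y. \<exists>i<?N. y = L ! i \<and> c \<noteq> ?cp x i \<or>
    y = across_end (L ! i) \<and> c \<noteq> ?cp x (Suc i)})"
  have of1: "L ! i \<in> of_coords (c, x) \<longleftrightarrow> c \<noteq> ?cp x i" if "i < ?N" for i c x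
    using that distinct traces_nonadjacent[OF assms(1)]
    by (auto simp: of_coords_def nth_eq_iff_index_eq; metis)
  have of2: "across_end (L ! i) \<in> of_coords (c, x) \<longleftrightarrow> c \<noteq> ?cp x (Suc i)" if "i < ?N" for i c x
    using that distinct traces_nonadjacent[OF assms(1)]
    by (auto simp: of_coords_def nth_eq_iff_index_eq; metis across_end_across_end nth_eq_iff_index_eq)
  have cross: "e \<in> snd (coords h) \<longleftrightarrow> (L ! i \<in> h) \<noteq> (across_end (L ! i) \<in> h)"
    if i: "i < ?N" "fst (L ! i) = e" "e \<in> A" "\<forall>j. (e, False, j) \<in> h \<longleftrightarrow> (e, True, j) \<in> h" for e h i
  proof -
    obtain b j where "L ! i = (e, b, j)" using i(2) by (metis prod.collapse)
    then show ?thesis using i by (cases b; cases j) (auto simp: coords_def)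
  qed
  have Inv_coords: "L ! i \<in> h \<longleftrightarrow> fst (coords h) \<noteq> ?cp (snd (coords h)) i"
      "across_end (L ! i) \<in> h \<longleftrightarrow> fst (coords h) \<noteq> ?cp (snd (coords h)) (Suc i)"
    if h: "h \<in> Inv" and i: "i < ?N" for h i
  proof -
    have inv: "rg_arc B y \<in> h \<longleftrightarrow> y \<in> h" "?g y \<in> h \<longleftrightarrow> y \<in> h" if "y \<in> corners B" for y
      using h that unfolding Inv_def by blast+
    have cross': "across_end (L ! i) \<in> h \<longleftrightarrow> (L ! i \<in> h) \<noteq> (fst (L ! i) \<in> snd (coords h))"
      if "i < ?N" for i
    proof (cases "fst (L ! i) \<in> A")
      case True
      have "(fst (L ! i), False, j) \<in> h \<longleftrightarrow> (fst (L ! i), True, j) \<in> h" for j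
        using inv(2)[of "(fst (L ! i), False, j)"] True assms(2) by (auto simp: in_corners_iff)
      then show ?thesis using cross[OF that refl True] by blast
    next
      case False
      then show ?thesis using inv(2)[of "L ! i"] in_corners[OF that] by (simp add: coords_def)
    qed
    have H: "L ! i \<in> h \<longleftrightarrow> fst (coords h) \<noteq> ?cp (snd (coords h)) i" if "i < ?N" for i
      using that
    proof (induction i)
      case (Suc i)
      have "L ! Suc i \<in> h \<longleftrightarrow> across_end (L ! i) \<in> h"
        using inv(1)[of "across_end (L ! i)"] in_corners[of i] step[of i] Suc.prems by simp
      then show ?case
        using Suc cross'[of i] crossing_parity_take_Suc[of i L "snd (coords h)"] by auto
    qed (simp add: coords_def crossing_parity_def)
    show "L ! i \<in> h \<longleftrightarrow> fst (coords h) \<noteq> ?cp (snd (coords h)) i" using H i .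
    show "across_end (L ! i) \<in> h \<longleftrightarrow> fst (coords h) \<noteq> ?cp (snd (coords h)) (Suc i)"
      using H[OF i] cross'[OF i] crossing_parity_take_Suc[OF i, of "snd (coords h)"] by auto
  qed
  have side_iff: "(\<forall>i j. (e, i, j) \<in> h \<longleftrightarrow> (e, \<not> i, j) \<in> h) \<longleftrightarrow>
      (odd (card {f \<in> x. {e, f} \<in> sg_edges (SI B)}) \<longleftrightarrow> e \<in> x \<and> e \<notin> sg_pos (SI B))"
    if "e \<in> A" "x \<subseteq> A" "\<And>i. i < ?N \<Longrightarrow> L ! i \<in> h \<longleftrightarrow> c \<noteq> ?cp x i"
      "\<And>i. i < ?N \<Longrightarrow> across_end (L ! i) \<in> h \<longleftrightarrow> c \<noteq> ?cp x (Suc i)" for e x h c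
    unfolding SI_eq_word_graph[OF assms(1)]
    using that assms(2) by (intro along_side_invariant_iff[OF L]) auto
  have "bij_betw coords Inv (UNIV \<times> nullspace (SI B) A)"
  proof (rule bij_betw_byWitness[where f' = of_coords])
    show "\<forall>h\<in>Inv. of_coords (coords h) = h"
    proof
      fix h assume h: "h \<in> Inv"
      have sub: "h \<subseteq> corners B" using h unfolding Inv_def by blast
      have sub': "of_coords (coords h) \<subseteq> corners B"
        using in_corners by (auto simp: of_coords_def split_beta)
      have "y \<in> of_coords (coords h) \<longleftrightarrow> y \<in> h" if "y \<in> corners B" for y
        using corner_cases[OF that] Inv_coords[OF h] of1 of2 by (metis prod.collapse)
      then show "of_coords (coords h) = h" using sub sub' by blast
    qed
    show "coords ` Inv \<subseteq> UNIV \<times> nullspace (SI B) A"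
    proof (rule image_subsetI)
      fix h assume h: "h \<in> Inv"
      have "snd (coords h) \<subseteq> A" by (auto simp: coords_def)
      moreover have "\<forall>i j. (e, i, j) \<in> h \<longleftrightarrow> (e, \<not> i, j) \<in> h" if "e \<in> A" for e
      proof (intro allI)
        fix i j
        have "(e, i, j) \<in> corners B" using that assms(2) by (auto simp: in_corners_iff)
        then show "(e, i, j) \<in> h \<longleftrightarrow> (e, \<not> i, j) \<in> h"
          using h that unfolding Inv_def by fastforce
      qed
      ultimately have "snd (coords h) \<in> nullspace (SI B) A"
        unfolding nullspace_def using side_iff[OF _ _ Inv_coords[OF h]] by blast
      then show "coords h \<in> UNIV \<times> nullspace (SI B) A" by (simp add: mem_Times_iff)
    qed
    show "of_coords ` (UNIV \<times> nullspace (SI B) A) \<subseteq> Inv"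
      and "\<forall>a\<in>UNIV \<times> nullspace (SI B) A. coords (of_coords a) = a"
    proof -
      have "of_coords (c, x) \<in> Inv \<and> coords (of_coords (c, x)) = (c, x)"
        if x: "x \<in> nullspace (SI B) A" for c x
      proof -
        let ?h = "of_coords (c, x)"
        have xA: "x \<subseteq> A" using x by (simp add: nullspace_def)
        have sides: "(e, i, j) \<in> ?h \<longleftrightarrow> (e, \<not> i, j) \<in> ?h" if "e \<in> A" for e i j
          using side_iff[OF that xA of1[of _ c x] of2[of _ c x]] x that unfolding nullspace_def by blast
        \<comment> \<open>At the wrap-around the prefix jumps from the whole word to the empty one;
          the total parity is even.\<close>
        have cp_N: "?cp x (Suc i mod ?N) = ?cp x (Suc i)" if "i < ?N" for i
        proof (cases "Suc i = ?N")
          case True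
          have "\<not> crossing_parity x L"
            using xA assms(2) by (intro crossing_parity_boundary_word[OF L]) auto
          then show ?thesis using True by (simp add: crossing_parity_def)
        qed (use that in simp)
        have arc_step: "across_end (L ! i) \<in> ?h \<longleftrightarrow> L ! (Suc i mod ?N) \<in> ?h" if "i < ?N" for i
          using of1[of "Suc i mod ?N"] of2[OF that] cp_N[OF that] N by simp
        have "rg_arc B y \<in> ?h \<longleftrightarrow> y \<in> ?h" if y: "y \<in> corners B" for y
        proof -
          obtain i where i: "i < ?N" "y = L ! i \<or> y = across_end (L ! i)"
            using corner_cases[OF y] by blast
          show ?thesis
          proof (cases "y = across_end (L ! i)")
            case True
            then show ?thesis using step arc_step i(1) by simp
          next
            case False
            \<comment> \<open>The cyclic predecessor of \<open>i\<close>; adding \<open>?N\<close>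
              covers \<open>i = 0\<close>.\<close>
            define k where "k = (i + ?N - 1) mod ?N"
            have k: "k < ?N" "Suc k mod ?N = i"
              using N i(1) by (simp_all add: k_def mod_Suc_eq)
            then have "rg_arc B y = across_end (L ! k)"
              using step[OF k(1)] arc(2)[OF in_corners(2)[OF k(1)]] False i(2) by simp
            then show ?thesis using arc_step[OF k(1)] k(2) False i(2) by simp
          qed
        qed
        moreover have "?g y \<in> ?h \<longleftrightarrow> y \<in> ?h" if y: "y \<in> corners B" for y
        proof (cases "fst y \<in> A")
          case True
          then show ?thesis using sides[of "fst y" "fst (snd y)" "snd (snd y)"] by (cases y) simp
        next
          case False
          obtain i where i: "i < ?N" "y = L ! i \<or> y = across_end (L ! i)"
            using corner_cases[OF y] by blast
          then have "fst (L ! i) \<notin> x" using xA False by auto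
          then have "?cp x (Suc i) = ?cp x i" using i by (simp add: crossing_parity_take_Suc)
          then have "across_end (L ! i) \<in> ?h \<longleftrightarrow> L ! i \<in> ?h"
            using of1[OF i(1), of c x] of2[OF i(1), of c x] by blast
          then show ?thesis using i(2) False by auto
        qed
        moreover have "?h \<subseteq> corners B" using in_corners by (auto simp: of_coords_def)
        ultimately have "?h \<in> Inv" unfolding Inv_def by blast
        moreover have "fst (coords ?h) = c"
          using of1[OF N, of c x] by (simp add: coords_def crossing_parity_def)
        moreover have "snd (coords ?h) = x"
        proof (rule set_eqI)
          fix e
          show "e \<in> snd (coords ?h) \<longleftrightarrow> e \<in> x"
          proof (cases "e \<in> A")
            case True
            then have "(e, False, False) \<in> corners B" using assms(2) by (auto simp: in_corners_iff)
            then obtain i where i: "i < ?N" "fst (L ! i) = e"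
              using corner_cases by (metis fst_across_end fst_conv)
            have "e \<in> snd (coords ?h) \<longleftrightarrow> (L ! i \<in> ?h) \<noteq> (across_end (L ! i) \<in> ?h)"
              using i True sides[OF True, of False] by (intro cross) auto
            then show ?thesis
              using of1[OF i(1), of c x] of2[OF i(1), of c x] crossing_parity_take_Suc[OF i(1), of x] i(2)
              by blast
          next
            case False
            then show ?thesis using xA by (auto simp: coords_def)
          qed
        qed
        ultimately show ?thesis by (simp add: prod_eq_iff)
      qed
      then show "of_coords ` (UNIV \<times> nullspace (SI B) A) \<subseteq> Inv"
        and "\<forall>a\<in>UNIV \<times> nullspace (SI B) A. coords (of_coords a) = a" by auto
    qed
  qed
  then have "card Inv = 2 * card (nullspace (SI B) A)"
    by (simp add: bij_betw_same_card card_cartesian_product)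
  moreover have "card Inv = 2 ^ card (orbits (corners B) (rg_arc B) ?g)"
    unfolding Inv_def
  proof (rule card_invariant_sets)
    show "finite (corners B)" using rg by (simp add: ribbon_graph_def corners_def)
  qed (use arc in \<open>auto simp: in_corners_iff\<close>)
  ultimately show ?thesis by (simp add: num_subgraph_boundaries_def iso)
qed

text \<open>For the empty edge set the kernel is trivial, so there is one boundary component, and
  these components are the vertices.\<close>

lemma traces_bouquet:
  assumes "traces B L"
  shows "bouquet B"
proof -
  have "nullspace (SI B) {} = {{}}" by (auto simp: nullspace_def)
  then have "2 ^ num_subgraph_boundaries B {} = (2::nat) ^ 1"
    using power_num_subgraph_boundaries[OF assms, of "{}"] by simp
  then have "num_subgraph_boundaries B {} = 1" by (rule power_inject_exp[THEN iffD1, rotated]) simp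
  then show ?thesis
    using assms by (simp add: bouquet_def traces_def num_vertices_def num_subgraph_boundaries_def)
qed

subsection \<open>Vertex deletion and pendant vertices\<close>

lemma num_subgraph_boundaries_cong:
  assumes "bouquet B" "bouquet B'" "A \<subseteq> rg_edges B" "A \<subseteq> rg_edges B'"
    and "nullspace (SI B) A = nullspace (SI B') A"
  shows "num_subgraph_boundaries B A = num_subgraph_boundaries B' A"
proof -
  obtain L L' where "traces B L" "traces B' L'"
    using assms(1,2) by (metis bouquet_traces)
  then have "(2::nat) ^ num_subgraph_boundaries B A = 2 ^ num_subgraph_boundaries B' A"
    using assms(3-5) by (simp add: power_num_subgraph_boundaries)
  then show ?thesis by simp
qed

text \<open>The kernel consists of subsets of \<open>A\<close>. The bound keeps \<open>nat\<close>
  from truncating in the genus formula.\<close>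

lemma num_subgraph_boundaries_le:
  assumes "bouquet B" "A \<subseteq> rg_edges B"
  shows "num_subgraph_boundaries B A \<le> card A + 1"
proof -
  obtain L where "traces B L" using assms(1) by (rule bouquet_traces)
  have "finite (rg_edges B)" using assms(1) by (simp add: bouquet_def ribbon_graph_def)
  then have "finite A" using assms(2) finite_subset by blast
  then have "card (nullspace (SI B) A) \<le> card (Pow A)"
    by (intro card_mono) (auto simp: nullspace_def)
  then have "(2::nat) ^ num_subgraph_boundaries B A \<le> 2 ^ (card A + 1)"
    using power_num_subgraph_boundaries[OF \<open>traces B L\<close> assms(2)] \<open>finite A\<close>
    by (simp add: card_Pow)
  then show ?thesis by (rule power_le_imp_le_exp[rotated]) simp
qed

lemma rg_edges_eq_sg_verts: "rg_edges B = sg_verts (SI B)"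
  by (simp add: SI_def)

text \<open>Justifies the definite description: the boundary counts, and with them the genera,
  depend only on the graph.\<close>

lemma intersection_poly_SI:
  assumes "bouquet B"
  shows "intersection_poly (SI B) = partial_dual_genus_poly B"
proof -
  have "partial_dual_genus_poly B' = partial_dual_genus_poly B"
    if "bouquet B'" "SI B' = SI B" for B'
  proof -
    have E: "rg_edges B' = rg_edges B" using that(2) by (simp add: rg_edges_eq_sg_verts)
    have "num_subgraph_boundaries B' A = num_subgraph_boundaries B A" if "A \<subseteq> rg_edges B" for A
      using that \<open>bouquet B'\<close> assms E \<open>SI B' = SI B\<close> by (intro num_subgraph_boundaries_cong) auto
    then show ?thesis
      unfolding partial_dual_genus_poly_def E euler_genus_partial_dual
      by (intro sum.cong) auto
  qed
  then show ?thesis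
    unfolding intersection_poly_def using assms by (intro the_equality) metis+
qed

text \<open>Delete the two letters of \<open>v\<close> from a boundary word and realise the
  remaining word by a bouquet.\<close>

lemma bouquet_delete_vertex:
  assumes "bouquet B"
  obtains B' where "bouquet B'" "SI B' = delete_vertex (SI B) v" "rg_edges B' = rg_edges B - {v}"
proof -
  obtain L where L: "traces B L" using assms by (rule bouquet_traces)
  have "boundary_word (rg_edges B) L" using L unfolding traces_def by blast
  then obtain B' where B': "traces B' (filter (\<lambda>y. fst y \<noteq> v) L)" "rg_edges B' = rg_edges B - {v}"
    using traces_exists[OF boundary_word_filter] by metis
  show thesis
  proof (rule that)
    show "bouquet B'" using B'(1) by (rule traces_bouquet)
    show "SI B' = delete_vertex (SI B) v"
      unfolding SI_eq_word_graph[OF L] SI_eq_word_graph[OF B'(1)] delete_vertex_word_graph B'(2) ..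
  qed (rule B')
qed

lemma nullspace_delete_vertex:
  assumes "v \<notin> A"
  shows "nullspace (delete_vertex SG v) A = nullspace SG A"
proof -
  have "{f \<in> x. {e, f} \<in> sg_edges (delete_vertex SG v)} = {f \<in> x. {e, f} \<in> sg_edges SG}"
    "e \<notin> sg_pos (delete_vertex SG v) \<longleftrightarrow> e \<notin> sg_pos SG"
    if "e \<in> A" "x \<subseteq> A" for e x
    using assms that by (auto simp: delete_vertex_def)
  then show ?thesis
    unfolding nullspace_def by (intro Collect_cong conj_cong ball_cong) auto
qed

text \<open>The row and the column of \<open>v1\<close> vanish, the diagonal entry because
  \<open>v1\<close> is positive, so the coordinate at \<open>v1\<close> is free.\<close>

lemma card_nullspace_insert_leaf:
  assumes fin: "finite A" and leaf: "\<And>u. u \<in> insert v1 A \<Longrightarrow> {v1, u} \<notin> sg_edges SG"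
    and pos: "v1 \<in> sg_pos SG" and "v1 \<notin> A"
  shows "card (nullspace SG (insert v1 A)) = 2 * card (nullspace SG A)"
proof -
  have nbr: "{f \<in> insert v1 x. {e, f} \<in> sg_edges SG} = {f \<in> x. {e, f} \<in> sg_edges SG}"
    if "e \<in> insert v1 A" for e x
    using leaf[OF that] by (auto simp: insert_commute)
  have nbr1: "{f \<in> x. {v1, f} \<in> sg_edges SG} = {}" if "x \<subseteq> insert v1 A" for x
    using leaf that by blast
  have A: "x \<in> nullspace SG (insert v1 A) \<longleftrightarrow> x \<in> nullspace SG A" if "x \<subseteq> A" for x
  proof -
    have "x \<subseteq> insert v1 A" using that by blast
    then have "even (card {f \<in> x. {v1, f} \<in> sg_edges SG})" using nbr1[of x] by (simp only: card.empty even_zero)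
    then show ?thesis using that pos by (auto simp: nullspace_def)
  qed
  have B: "insert v1 x \<in> nullspace SG (insert v1 A) \<longleftrightarrow> x \<in> nullspace SG A" if "x \<subseteq> A" for x
  proof -
    have "x \<subseteq> insert v1 A" using that by blast
    then have "even (card {f \<in> x. {v1, f} \<in> sg_edges SG})"
      using nbr1[of x] by (simp only: card.empty even_zero)
    then show ?thesis using that nbr pos \<open>v1 \<notin> A\<close> by (auto simp: nullspace_def)
  qed
  have "nullspace SG (insert v1 A) = nullspace SG A \<union> insert v1 ` nullspace SG A"
  proof (intro set_eqI iffI)
    fix x assume x: "x \<in> nullspace SG (insert v1 A)"
    then have sub: "x - {v1} \<subseteq> A" by (auto simp: nullspace_def)
    show "x \<in> nullspace SG A \<union> insert v1 ` nullspace SG A"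
    proof (cases "v1 \<in> x")
      case True
      then have "insert v1 (x - {v1}) = x" by blast
      then show ?thesis using B[OF sub] x by (metis UnI2 imageI)
    next
      case False
      then show ?thesis using A[of x] x sub by simp
    qed
  next
    fix x assume "x \<in> nullspace SG A \<union> insert v1 ` nullspace SG A"
    then obtain y where y: "y \<in> nullspace SG A" "x = y \<or> x = insert v1 y" by blast
    then have "y \<subseteq> A" by (simp add: nullspace_def)
    then show "x \<in> nullspace SG (insert v1 A)" using y A[of y] B[of y] by metis
  qed
  moreover have "finite (nullspace SG A)"
    using fin by (simp add: nullspace_def)
  moreover have notin: "v1 \<notin> x" if "x \<in> nullspace SG A" for x
    using that \<open>v1 \<notin> A\<close> by (auto simp: nullspace_def)
  then have "inj_on (insert v1) (nullspace SG A)"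
    by (intro inj_onI) (metis insert_ident)
  moreover have "nullspace SG A \<inter> insert v1 ` nullspace SG A = {}"
    using notin by blast
  ultimately show ?thesis
    by (simp add: card_Un_disjoint card_image)
qed

text \<open>Row \<open>v1\<close> has its only entry at \<open>v2\<close> and forces that coordinate
  to be 0; row \<open>v2\<close> then determines the coordinate at \<open>v1\<close>, which no other
  row involves.\<close>

lemma card_nullspace_insert_pendant:
  assumes fin: "finite A"
    and pendant: "\<And>u. u \<in> insert v1 (insert v2 A) \<Longrightarrow> {v1, u} \<in> sg_edges SG \<longleftrightarrow> u = v2"
    and pos: "v1 \<in> sg_pos SG" and "v1 \<notin> A" "v2 \<notin> A" "v1 \<noteq> v2"
  shows "card (nullspace SG (insert v1 (insert v2 A))) = card (nullspace SG A)"
proof -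
  let ?nb = "\<lambda>x e. {f \<in> x. {e, f} \<in> sg_edges SG}"
  have nbr: "?nb (insert v1 x) e = ?nb x e" if "e \<in> A" for e x
    using pendant[of e] that \<open>v2 \<notin> A\<close> by (auto simp: insert_commute)
  have nbr2: "?nb (insert v1 x) v2 = insert v1 (?nb x v2)" for x
    using pendant[of v2] by (auto simp: insert_commute)
  have parity2: "odd (card (?nb (insert v1 x) v2)) \<longleftrightarrow> even (card (?nb x v2))" if "x \<subseteq> A" for x
  proof -
    have "finite (?nb x v2)" "v1 \<notin> ?nb x v2"
      using that fin \<open>v1 \<notin> A\<close> by (auto intro: finite_subset[of _ A])
    then show ?thesis unfolding nbr2 by simp
  qed
  have v2: "v2 \<notin> x" if "x \<in> nullspace SG (insert v1 (insert v2 A))" for x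
  proof
    assume "v2 \<in> x"
    then have "?nb x v1 = {v2}"
      using that pendant by (auto simp: nullspace_def)
    moreover have "odd (card (?nb x v1)) \<longleftrightarrow> v1 \<in> x \<and> v1 \<notin> sg_pos SG"
      using that unfolding nullspace_def by blast
    ultimately show False using pos by simp
  qed
  have mem: "x \<in> nullspace SG (insert v1 (insert v2 A)) \<longleftrightarrow>
      x - {v1} \<in> nullspace SG A \<and> (v1 \<in> x \<longleftrightarrow> odd (card (?nb (x - {v1}) v2)))"
    if x: "x - {v1} \<subseteq> A" for x
  proof -
    have "?nb x v1 = {}"
      using x pendant \<open>v2 \<notin> A\<close> \<open>v1 \<noteq> v2\<close> by blast
    then have "even (card (?nb x v1))" by (simp only: card.empty even_zero)
    moreover have "?nb x e = ?nb (x - {v1}) e" if "e \<in> A" for e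
      using nbr[OF that, of "x - {v1}"] by (cases "v1 \<in> x") (simp_all add: insert_absorb)
    moreover have "odd (card (?nb x v2)) \<longleftrightarrow> (v1 \<in> x \<longleftrightarrow> even (card (?nb (x - {v1}) v2)))"
      using parity2[OF x] by (cases "v1 \<in> x") (simp_all add: insert_absorb)
    moreover have "v2 \<notin> x" using x \<open>v2 \<notin> A\<close> \<open>v1 \<noteq> v2\<close> by blast
    moreover have "e \<in> x - {v1} \<longleftrightarrow> e \<in> x" if "e \<in> A" for e
      using that \<open>v1 \<notin> A\<close> by blast
    ultimately show ?thesis
      using x pos by (auto simp: nullspace_def)
  qed
  have "bij_betw (\<lambda>x. x - {v1}) (nullspace SG (insert v1 (insert v2 A))) (nullspace SG A)"
  proof (rule bij_betw_imageI)
    have sub: "x - {v1} \<subseteq> A" if "x \<in> nullspace SG (insert v1 (insert v2 A))" for x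
      using v2[OF that] that by (auto simp: nullspace_def)
    show "inj_on (\<lambda>x. x - {v1}) (nullspace SG (insert v1 (insert v2 A)))"
    proof (rule inj_onI)
      fix x y assume xy: "x \<in> nullspace SG (insert v1 (insert v2 A))"
        "y \<in> nullspace SG (insert v1 (insert v2 A))" "x - {v1} = y - {v1}"
      then have "v1 \<in> x \<longleftrightarrow> v1 \<in> y" 
        using mem[OF sub[OF xy(1)]] mem[OF sub[OF xy(2)]] by simp
      then show "x = y" using xy(3) by blast
    qed
    show "(\<lambda>x. x - {v1}) ` nullspace SG (insert v1 (insert v2 A)) = nullspace SG A"
    proof (intro set_eqI iffI)
      fix y assume "y \<in> (\<lambda>x. x - {v1}) ` nullspace SG (insert v1 (insert v2 A))"
      then show "y \<in> nullspace SG A" using mem[OF sub] by blast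
    next
      fix y assume y: "y \<in> nullspace SG A"
      then have "y \<subseteq> A" by (simp add: nullspace_def)
      then have "v1 \<notin> y" using \<open>v1 \<notin> A\<close> by blast
      \<comment> \<open>The vertex \<open>v1\<close> is added exactly when row \<open>v2\<close> has
        to be corrected.\<close>
      define x where "x = (if odd (card (?nb y v2)) then insert v1 y else y)"
      have "x - {v1} = y" using \<open>v1 \<notin> y\<close> by (simp add: x_def)
      moreover have "v1 \<in> x \<longleftrightarrow> odd (card (?nb y v2))" using \<open>v1 \<notin> y\<close> by (simp add: x_def)
      ultimately have "x \<in> nullspace SG (insert v1 (insert v2 A))"
        using mem[of x] y \<open>y \<subseteq> A\<close> by simp
      then show "y \<in> (\<lambda>x. x - {v1}) ` nullspace SG (insert v1 (insert v2 A))"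
        using \<open>x - {v1} = y\<close> by blast
    qed
  qed
  then show ?thesis by (rule bij_betw_same_card)
qed

lemma sum_Pow_insert:
  assumes "finite S" "a \<notin> S"
  shows "sum F (Pow (insert a S)) = (\<Sum>X\<in>Pow S. F X + F (insert a X))"
proof -
  have "inj_on (insert a) (Pow S)"
    using assms(2) by (intro inj_onI) (metis PowD insert_ident subsetD)
  moreover have "Pow S \<inter> insert a ` Pow S = {}" using assms(2) by blast
  ultimately show ?thesis
    using assms(1) by (simp add: Pow_insert sum.union_disjoint sum.reindex sum.distrib)
qed

theorem theorem14:
  fixes SG :: "'e signed_graph" and v1 v2 :: 'e
  assumes "signed_intersection_graph SG"
    and "v1 \<in> sg_verts SG" and "v2 \<in> sg_verts SG"
    and "{v1, v2} \<in> sg_edges SG"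
    and "sg_degree SG v1 = 1"
    and "v1 \<in> sg_pos SG"
  shows "intersection_poly SG =
    intersection_poly (delete_vertex SG v1) +
    monom 2 2 * intersection_poly (delete_vertex (delete_vertex SG v1) v2)"
proof -
  obtain B where B: "bouquet B" and SG: "SG = SI B"
    using assms(1) unfolding signed_intersection_graph_def by blast
  obtain B1 where B1: "bouquet B1" "SI B1 = delete_vertex (SI B) v1" "rg_edges B1 = rg_edges B - {v1}"
    using B by (rule bouquet_delete_vertex)
  obtain B2 where B2: "bouquet B2" "SI B2 = delete_vertex (SI B1) v2" "rg_edges B2 = rg_edges B1 - {v2}"
    using B1(1) by (rule bouquet_delete_vertex)
  have "v1 \<noteq> v2"
    using assms(4) by (auto simp: SG SI_def)
  define S where "S = rg_edges B - {v1, v2}"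
  have "v1 \<in> rg_edges B" "v2 \<in> rg_edges B"
    using assms(2,3) by (simp_all add: SG rg_edges_eq_sg_verts)
  then have E: "rg_edges B = insert v1 (insert v2 S)" "rg_edges B1 = insert v2 S" "rg_edges B2 = S"
    using \<open>v1 \<noteq> v2\<close> by (auto simp: S_def B1(3) B2(3))
  have v: "v1 \<notin> S" "v2 \<notin> S" by (simp_all add: S_def)
  have fin: "finite S"
    using B by (simp add: S_def bouquet_def ribbon_graph_def)
  have pendant: "{v1, u} \<in> sg_edges SG \<longleftrightarrow> u = v2" if "u \<in> rg_edges B" for u
  proof -
    obtain w where "{u \<in> sg_verts SG. {v1, u} \<in> sg_edges SG} = {w}"
      using assms(5) unfolding sg_degree_def by (rule card_1_singletonE)
    then have "z \<in> sg_verts SG \<and> {v1, z} \<in> sg_edges SG \<longleftrightarrow> z = w" for z by blast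
    then show ?thesis
      using assms(3,4) that unfolding SG rg_edges_eq_sg_verts by metis
  qed
  let ?f = "num_subgraph_boundaries B"
  obtain L where L: "traces B L" using B by (rule bouquet_traces)
  note pow = power_num_subgraph_boundaries[OF L, folded SG]
  have f1: "num_subgraph_boundaries B1 A = ?f A" if "A \<subseteq> insert v2 S" for A
  proof (rule num_subgraph_boundaries_cong[OF B1(1) B])
    have "v1 \<notin> A" using that v \<open>v1 \<noteq> v2\<close> by blast
    then show "nullspace (SI B1) A = nullspace (SI B) A"
      unfolding B1(2) by (rule nullspace_delete_vertex)
  qed (use that E in auto)
  have f2: "num_subgraph_boundaries B2 A = ?f A" if "A \<subseteq> S" for A
  proof -
    have "num_subgraph_boundaries B2 A = num_subgraph_boundaries B1 A"
    proof (rule num_subgraph_boundaries_cong[OF B2(1) B1(1)])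
      have "v2 \<notin> A" using that v by blast
      then show "nullspace (SI B2) A = nullspace (SI B1) A"
        unfolding B2(2) by (rule nullspace_delete_vertex)
    qed (use that E in auto)
    then show ?thesis using f1[of A] that by auto
  qed
  have leaf: "?f (insert v1 X) = Suc (?f X)" if "X \<subseteq> S" for X
  proof -
    have "card (nullspace SG (insert v1 X)) = 2 * card (nullspace SG X)"
      using that v fin pendant E \<open>v1 \<noteq> v2\<close> assms(6)
      by (intro card_nullspace_insert_leaf) (auto intro: finite_subset)
    moreover have "insert v1 X \<subseteq> rg_edges B" "X \<subseteq> rg_edges B" using that E(1) by auto
    ultimately have "2 ^ ?f (insert v1 X) = (2::nat) ^ Suc (?f X)"
      by (simp only: pow power_Suc)
    then show ?thesis by (simp only: power_inject_exp one_less_numeral_iff semiring_norm)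
  qed
  have both: "?f (insert v1 (insert v2 X)) = ?f X" if "X \<subseteq> S" for X
  proof -
    have "card (nullspace SG (insert v1 (insert v2 X))) = card (nullspace SG X)"
      using that v fin pendant E \<open>v1 \<noteq> v2\<close> assms(6)
      by (intro card_nullspace_insert_pendant) (auto intro: finite_subset)
    moreover have "insert v1 (insert v2 X) \<subseteq> rg_edges B" "X \<subseteq> rg_edges B" using that E(1) by auto
    ultimately have "2 ^ ?f (insert v1 (insert v2 X)) = (2::nat) ^ ?f X"
      by (simp only: pow)
    then show ?thesis by simp
  qed
  have card: "card (rg_edges B) = card S + 2" "card (rg_edges B1) = card S + 1" "card (rg_edges B2) = card S"
    using E fin v \<open>v1 \<noteq> v2\<close> by simp_all
  let ?g = "\<lambda>B A. euler_genus (partial_dual B A)"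
  let ?m = "\<lambda>B A. monom (1::int) (?g B A)"
  \<comment> \<open>If \<open>v1\<close> and \<open>v2\<close> lie on the same side, both boundary
    counts are those for \<open>S\<close>, and the two extra edges raise the genus by 2. If they are
    separated, \<open>v1\<close> adds one edge and one boundary component, which cancel.\<close>
  have terms: "?g B X = 2 + ?g B2 X" "?g B (insert v1 (insert v2 X)) = 2 + ?g B2 X"
    "?g B (insert v2 X) = ?g B1 (insert v2 X)" "?g B (insert v1 X) = ?g B1 X"
    if X: "X \<subseteq> S" for X
  proof -
    let ?Y = "S - X"
    have Y: "?Y \<subseteq> S" by blast
    have compl: "rg_edges B - X = insert v1 (insert v2 ?Y)"
      "rg_edges B - insert v1 (insert v2 X) = ?Y"
      "rg_edges B - insert v2 X = insert v1 ?Y" "rg_edges B - insert v1 X = insert v2 ?Y"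
      "rg_edges B1 - insert v2 X = ?Y" "rg_edges B1 - X = insert v2 ?Y" "rg_edges B2 - X = ?Y"
      using X v \<open>v1 \<noteq> v2\<close> unfolding E by auto
    have "?f X + ?f ?Y \<le> (card X + 1) + (card ?Y + 1)"
      using X E by (intro add_mono num_subgraph_boundaries_le[OF B]) auto
    also have "\<dots> = card S + 2"
      using X fin by (simp add: card_Diff_subset finite_subset card_mono)
    \<comment> \<open>The integer in the genus of the dual of \<open>B2\<close> is thus nonnegative,
      so adding 2 commutes with \<open>nat\<close>.\<close>
    finally have le: "?f X + ?f ?Y \<le> card S + 2" .
    have sub: "X \<subseteq> insert v2 S" "?Y \<subseteq> insert v2 S" "insert v2 X \<subseteq> insert v2 S" "insert v2 ?Y \<subseteq> insert v2 S"
      using X by auto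
    show "?g B X = 2 + ?g B2 X" "?g B (insert v1 (insert v2 X)) = 2 + ?g B2 X"
      "?g B (insert v2 X) = ?g B1 (insert v2 X)" "?g B (insert v1 X) = ?g B1 X"
      unfolding euler_genus_partial_dual compl card f1[OF sub(1)] f1[OF sub(2)] f1[OF sub(3)]
        f1[OF sub(4)] f2[OF X] f2[OF Y] leaf[OF X] leaf[OF Y] both[OF X] both[OF Y]
      using le by linarith+
  qed
  \<comment> \<open>Each edge set is recorded by its part \<open>X\<close> in \<open>S\<close> and
    by which of \<open>v1\<close> and \<open>v2\<close> it contains.\<close>
  have "partial_dual_genus_poly B = (\<Sum>X\<in>Pow S. ?m B X + ?m B (insert v2 X)
      + (?m B (insert v1 X) + ?m B (insert v1 (insert v2 X))))"
    unfolding partial_dual_genus_poly_def E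
    using fin v \<open>v1 \<noteq> v2\<close> by (simp add: sum_Pow_insert sum.distrib)
  also have "\<dots> = (\<Sum>X\<in>Pow S. ?m B1 X + ?m B1 (insert v2 X)
      + monom 2 2 * ?m B2 X)"
  proof (rule sum.cong)
    fix X assume "X \<in> Pow S"
    then have X: "X \<subseteq> S" by simp
    have "monom (2::int) 2 * ?m B2 X = monom 1 (2 + ?g B2 X) + monom 1 (2 + ?g B2 X)"
      by (simp add: mult_monom add_monom)
    then show "?m B X + ?m B (insert v2 X) + (?m B (insert v1 X) + ?m B (insert v1 (insert v2 X))) =
        ?m B1 X + ?m B1 (insert v2 X) + monom 2 2 * ?m B2 X"
      unfolding terms[OF X] by simp
  qed simp
  also have "\<dots> = partial_dual_genus_poly B1 + monom 2 2 * partial_dual_genus_poly B2"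
    unfolding partial_dual_genus_poly_def E
    using fin v by (simp add: sum_Pow_insert sum.distrib sum_distrib_left)
  finally show ?thesis
    using intersection_poly_SI[OF B] intersection_poly_SI[OF B1(1)] intersection_poly_SI[OF B2(1)]
    by (simp add: SG B1(2) B2(2))
qed

end
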